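(* (i) Let $k\ge 2$. Among all trees with $n$ vertices and diameter $d=2k-1$, the minimal distance spectral radius is attained uniquely (up to isomorphism) at $\mathcal{T}_1$; that is, every tree $T$ with $n$ vertices and diameter $2k-1$ satisfies $\varrho(T)\ge\varrho(\mathcal{T}_1)$, with equality if and only if $T\cong\mathcal{T}_1$. Here $\mathcal{T}_1$ is the tree of order $n$ obtained by attaching $n-2k$ pendant edges to the vertex $v_1$ of the path $P_{2k}=v_kv_{k-1}\cdots v_1u_1u_2\cdots u_k$. (ii) Let $k\ge 1$. Among all trees with $n$ vertices and diameter $d=2k$, the minimal distance spectral radius is attained uniquely (up to isomorphism) at $\mathcal{T}_2$; that is, every tree $T$ with $n$ vertices and diameter $2k$ satisfies $\varrho(T)\ge\varrho(\mathcal{T}_2)$, with equality if and only if $T\cong\mathcal{T}_2$. Here $\mathcal{T}_2$ is the tree of order $n$ obtained by attaching $n-2k-1$ pendant edges to the vertex $v_0$ of the path $P_{2k+1}=v_kv_{k-1}\cdots v_1v_0u_1u_2\cdots u_k$.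
   Context: For a connected graph $G$ with vertices $v_1,\dots,v_n$, the distance $d_G(v_i,v_j)$ is the number of edges of a shortest path from $v_i$ to $v_j$. The distance matrix $D(G)$ is the $n\times n$ matrix whose $(i,j)$-entry is $d_G(v_i,v_j)$, and the distance spectral radius $\varrho(G)$ is the largest eigenvalue of $D(G)$. The diameter of a graph is the maximum distance between any pair of its vertices; a tree with $n$ vertices and diameter $d$ has $n\ge d+1$, so $n\ge 2k$ in (i) and $n\ge 2k+1$ in (ii). Attaching $m$ pendant edges to a vertex $v$ means adding $m$ new vertices, each adjacent only to $v$. *)

theory Defs
  imports "Graph_Theory.Graph_Theory" "Jordan_Normal_Form.Spectral_Radius"
begin

text \<open>
  A finite simple graph is modelled by the locale \<^locale>\<open>graph\<close>: a finite symmetric digraph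
  without loops and multiple arcs, so that every undirected edge corresponds to two opposite arcs.
  In particular, going forth and back along one edge is a \<^const>\<open>pre_digraph.cycle\<close> of length 2;
  the cycles of the undirected graph are those of length at least 3.  (For this reason the
  predicate \<open>tree\<close> of the library, which describes oriented trees, is not applicable here.)
\<close>

definition undirected_tree :: "('a, 'b) pre_digraph \<Rightarrow> bool" where
  "undirected_tree G \<longleftrightarrow> graph G \<and> Digraph_Component.connected G \<and>
     \<not> (\<exists>p. pre_digraph.cycle G p \<and> 3 \<le> length p)"

definition graph_dist :: "('a, 'b) pre_digraph \<Rightarrow> 'a \<Rightarrow> 'a \<Rightarrow> nat" where
  "graph_dist G u v = (LEAST l. \<exists>p. pre_digraph.apath G u p v \<and> length p = l)"

definition graph_diameter :: "('a, 'b) pre_digraph \<Rightarrow> nat" where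
  "graph_diameter G = Max {graph_dist G u v | u v. u \<in> verts G \<and> v \<in> verts G}"

definition vertex_enum :: "('a, 'b) pre_digraph \<Rightarrow> 'a list \<Rightarrow> bool" where
  "vertex_enum G vs \<longleftrightarrow> distinct vs \<and> set vs = verts G"

definition dist_matrix :: "('a, 'b) pre_digraph \<Rightarrow> 'a list \<Rightarrow> real mat" where
  "dist_matrix G vs =
     mat (length vs) (length vs) (\<lambda>(i, j). real (graph_dist G (vs ! i) (vs ! j)))"

text \<open>
  The matrix depends on the chosen enumeration of the vertices, but its eigenvalues do not;
  see \<open>dist_spectral_radius_eq\<close> below.  As the matrix is real symmetric, all its
  eigenvalues are real.
\<close>

definition dist_spectral_radius :: "('a, 'b) pre_digraph \<Rightarrow> real" where
  "dist_spectral_radius G = Max (spectrum (dist_matrix G (SOME vs. vertex_enum G vs)))"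

lemma spectrum_dist_matrix_subset:
  assumes vs: "vertex_enum G vs" and ws: "vertex_enum G ws"
  shows "spectrum (dist_matrix G vs) \<subseteq> spectrum (dist_matrix G ws)"
proof
  fix x assume "x \<in> spectrum (dist_matrix G vs)"
  then obtain v where v: "eigenvector (dist_matrix G vs) v x"
    by (auto simp: spectrum_def eigenvalue_def)
  define n where "n = length vs"
  have len: "length ws = n"
    using vs ws unfolding n_def vertex_enum_def by (metis distinct_card)
  have bv: "bij_betw ((!) vs) {..<n} (verts G)"
    using vs by (auto simp: vertex_enum_def n_def intro!: bij_betw_nth)
  have bw: "bij_betw ((!) ws) {..<n} (verts G)"
    using ws len by (auto simp: vertex_enum_def intro!: bij_betw_nth)
  define f where "f = the_inv_into {..<n} ((!) vs) \<circ> (!) ws"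
  have f: "bij_betw f {..<n} {..<n}"
    unfolding f_def using bij_betw_trans[OF bw bij_betw_the_inv_into[OF bv]] .
  have f_lt: "f i < n" if "i < n" for i
    using f that by (auto simp: bij_betw_def)
  have f_nth: "vs ! f i = ws ! i" if "i < n" for i
    using that bv bw unfolding f_def
    by (auto simp: bij_betw_def intro!: f_the_inv_into_f)
  have vdim: "v \<in> carrier_vec n" "v \<noteq> 0\<^sub>v n"
    and veq: "dist_matrix G vs *\<^sub>v v = x \<cdot>\<^sub>v v"
    using v by (auto simp: eigenvector_def dist_matrix_def n_def)
  have row: "(\<Sum>j<n. real (graph_dist G (vs ! i) (vs ! j)) * v $ j) = x * v $ i" if "i < n" for i
    using arg_cong[OF veq, of "\<lambda>u. u $ i"] that vdim
    by (auto simp: dist_matrix_def scalar_prod_def n_def lessThan_atLeast0)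
  define w where "w = vec n (\<lambda>i. v $ f i)"
  have "w \<noteq> 0\<^sub>v n"
  proof
    assume w0: "w = 0\<^sub>v n"
    have "v $ i = 0" if "i < n" for i
    proof -
      have "i \<in> f ` {..<n}" using f that by (simp add: bij_betw_def)
      then obtain j where j: "j < n" "i = f j" by auto
      have "w $ j = 0\<^sub>v n $ j" by (simp only: w0)
      then show ?thesis using j by (simp add: w_def)
    qed
    then have "v = 0\<^sub>v n" using vdim(1) by (intro eq_vecI) auto
    with vdim(2) show False by simp
  qed
  moreover have "dist_matrix G ws *\<^sub>v w = x \<cdot>\<^sub>v w"
  proof (rule eq_vecI)
    fix i assume "i < dim_vec (x \<cdot>\<^sub>v w)"
    then have i: "i < n" by (simp add: w_def)
    have "(dist_matrix G ws *\<^sub>v w) $ i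
        = (\<Sum>j<n. real (graph_dist G (vs ! f i) (vs ! f j)) * v $ f j)"
      using i len by (simp add: dist_matrix_def scalar_prod_def w_def lessThan_atLeast0 f_nth)
    also have "\<dots> = (\<Sum>j<n. real (graph_dist G (vs ! f i) (vs ! j)) * v $ j)"
      by (rule sum.reindex_bij_betw[OF f])
    also have "\<dots> = x * v $ f i" using row f_lt[OF i] by simp
    finally show "(dist_matrix G ws *\<^sub>v w) $ i = (x \<cdot>\<^sub>v w) $ i"
      using i by (simp add: w_def)
  qed (simp add: dist_matrix_def w_def len)
  moreover have "dim_row (dist_matrix G ws) = n" "w \<in> carrier_vec n"
    by (simp_all add: dist_matrix_def w_def len)
  ultimately have "eigenvector (dist_matrix G ws) w x"
    by (simp add: eigenvector_def)
  then show "x \<in> spectrum (dist_matrix G ws)"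
    by (auto simp: spectrum_def eigenvalue_def)
qed

lemma dist_spectral_radius_eq:
  assumes "vertex_enum G vs"
  shows "dist_spectral_radius G = Max (spectrum (dist_matrix G vs))"
proof -
  have "vertex_enum G (SOME vs. vertex_enum G vs)" using assms by (rule someI)
  then show ?thesis
    unfolding dist_spectral_radius_def
    using spectrum_dist_matrix_subset assms by (metis subset_antisym)
qed

definition path_graph :: "nat \<Rightarrow> nat pair_pre_digraph" where
  "path_graph m = \<lparr> pverts = {..<m}, parcs = {(i, j). i < m \<and> j < m \<and> (j = Suc i \<or> i = Suc j)} \<rparr>"

text \<open>The set \<open>W\<close> of new vertices is meant to be disjoint from the vertices of \<open>G\<close>.\<close>

definition attach_pendants :: "'a pair_pre_digraph \<Rightarrow> 'a \<Rightarrow> 'a set \<Rightarrow> 'a pair_pre_digraph" where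
  "attach_pendants G v W =
     \<lparr> pverts = pverts G \<union> W, parcs = parcs G \<union> {v} \<times> W \<union> W \<times> {v} \<rparr>"

text \<open>
  The path \<open>v\<^sub>k \<dots> v\<^sub>1 u\<^sub>1 \<dots> u\<^sub>k\<close> is numbered from left to right by \<open>0, \<dots>, 2k - 1\<close>, so that \<open>v\<^sub>1\<close>
  has number \<open>k - 1\<close>.  In the path \<open>v\<^sub>k \<dots> v\<^sub>1 v\<^sub>0 u\<^sub>1 \<dots> u\<^sub>k\<close>, numbered by \<open>0, \<dots>, 2k\<close>, the
  vertex \<open>v\<^sub>0\<close> has number \<open>k\<close>.
\<close>

definition T1 :: "nat \<Rightarrow> nat \<Rightarrow> (nat, nat \<times> nat) pre_digraph" where
  "T1 n k = with_proj (attach_pendants (path_graph (2 * k)) (k - 1) {2 * k..<n})"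

definition T2 :: "nat \<Rightarrow> nat \<Rightarrow> (nat, nat \<times> nat) pre_digraph" where
  "T2 n k = with_proj (attach_pendants (path_graph (2 * k + 1)) k {2 * k + 1..<n})"

end

theory Submission
  imports Defs "HOL-Analysis.Function_Topology"
begin

text \<open>
  The distance spectral radius is the maximum of a Rayleigh quotient, so it suffices to transplant
  the Perron vector of the extremal tree to an arbitrary tree \<open>T\<close> of the same order and diameter
  without decreasing its quadratic form.  All pendant vertices of the extremal tree carry the same
  value \<open>y\<close>; the path entries are put on a diametral path of \<open>T\<close>, and \<open>y\<close> on all other vertices.
  Moving a hanging vertex away from the centre or higher above the path increases its weighted
  distance to the path, as \<open>y\<close> is smaller than the total weight of the path and the two halves of
  the path are almost balanced.  The imbalance of the halves, which is present for odd diameter, is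
  compensated by the increased distances among the hanging vertices, provided the diametral path
  is oriented such that at least half of these vertices hang from the half containing the vertex
  that takes the place of the centre.
\<close>

section \<open>Quadratic forms and Perron vectors\<close>

text \<open>A vertex by vertex comparison with the extremal tree fails at two points. Adjacent
  vertices off the path are at distance 1 instead of 2; such a pair is charged to its child, where a
  unit of extra height costs \<open>2 * y\<^sup>2\<close> but gains \<open>2 * y\<close> times the
  total path weight, so \<open>y_less\<close> settles it. For odd diameter the pendant vertices
  break the mirror symmetry of the path, and a vertex moved to the right may come closer to the path
  weight, at a rate \<open>Rsum - Lsum\<close> per step. The remedy is collective: it also moves
  away from all vertices hanging on the left, and as these are at least half of the \<open>m\<close>
  vertices, \<open>2 * (Rsum - Lsum) < real m * y\<close> suffices. That bound comes from a
  recurrence for the differences of mirror entries of the Perron vector, together with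
  \<open>real d \<le> l\<close>. All these inequalities are strict, so equality pins down every
  height and index. In the arbitrary tree only lower bounds on distances enter; they come from
  integer functions that change by at most 1 along an edge.\<close>

definition quad_form :: "'a set \<Rightarrow> ('a \<Rightarrow> 'a \<Rightarrow> real) \<Rightarrow> ('a \<Rightarrow> real) \<Rightarrow> real" where
  "quad_form V A x = (\<Sum>u\<in>V. \<Sum>v\<in>V. A u v * x u * x v)"

lemma quad_form_cong:
  assumes "\<And>v. v \<in> V \<Longrightarrow> x v = y v"
  shows "quad_form V A x = quad_form V A y"
  using assms by (auto simp: quad_form_def intro!: sum.cong)

lemma quad_form_scale: "quad_form V A (\<lambda>v. c * x v) = c\<^sup>2 * quad_form V A x"
  by (simp add: quad_form_def sum_distrib_left power2_eq_square ac_simps)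

lemma quad_form_abs_ge:
  assumes "\<And>u v. u \<in> V \<Longrightarrow> v \<in> V \<Longrightarrow> 0 \<le> A u v"
  shows "quad_form V A x \<le> quad_form V A (\<lambda>v. \<bar>x v\<bar>)"
  unfolding quad_form_def
proof (intro sum_mono)
  fix u v assume "u \<in> V" "v \<in> V"
  then have "A u v * (x u * x v) \<le> A u v * (\<bar>x u\<bar> * \<bar>x v\<bar>)"
    by (intro mult_left_mono assms) (auto simp flip: abs_mult)
  then show "A u v * x u * x v \<le> A u v * \<bar>x u\<bar> * \<bar>x v\<bar>" by (simp add: mult.assoc)
qed

text \<open>Extended by zero outside \<open>V\<close>, the unit vectors form a closed subset of a
  product of compact sets, which is compact by Tychonoff's theorem; homogeneity then carries the
  bound from the unit sphere to every \<open>y\<close>.\<close>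

lemma quad_form_max:
  assumes fin: "finite V" and ne: "V \<noteq> {}"
  obtains x where "(\<Sum>v\<in>V. (x v)\<^sup>2) = 1"
    and "\<And>y. quad_form V A y \<le> quad_form V A x * (\<Sum>v\<in>V. (y v)\<^sup>2)"
proof -
  let ?C = "PiE UNIV (\<lambda>v. if v \<in> V then {-1..1::real} else {0})"
  define S where "S = ?C \<inter> {x. (\<Sum>v\<in>V. (x v)\<^sup>2) = 1}"
  have "compactin (product_topology (\<lambda>_. euclidean) UNIV) ?C"
    by (subst compactin_PiE) (auto simp: compactin_euclidean_iff)
  then have "compact ?C"
    by (simp add: euclidean_product_topology)
  moreover have "closed {x :: 'a \<Rightarrow> real. (\<Sum>v\<in>V. (x v)\<^sup>2) = 1}"
    by (intro closed_Collect_eq continuous_intros continuous_on_product_coordinates)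
  ultimately have "compact S" unfolding S_def by (rule compact_Int_closed)
  have in_S: "x \<in> S" if "(\<Sum>v\<in>V. (x v)\<^sup>2) = 1" "\<And>v. v \<notin> V \<Longrightarrow> x v = 0" for x
  proof -
    have "(x v)\<^sup>2 \<le> 1" if "v \<in> V" for v
      using member_le_sum[OF that, of "\<lambda>v. (x v)\<^sup>2"] fin \<open>(\<Sum>v\<in>V. (x v)\<^sup>2) = 1\<close> by simp
    then have "\<bar>x v\<bar> \<le> 1" if "v \<in> V" for v
      using that by (simp add: abs_square_le_1)
    then show ?thesis using that by (auto simp: S_def abs_le_iff)
  qed
  obtain a where a: "a \<in> V" using ne by auto
  have "(\<lambda>v. if v = a then 1 else 0) \<in> S"
    using a fin by (intro in_S) (auto simp: if_distrib[of "\<lambda>z. z\<^sup>2"] cong: if_cong)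
  then have "S \<noteq> {}" by auto
  moreover have "continuous_on S (quad_form V A)"
    unfolding quad_form_def
    by (intro continuous_intros continuous_on_subset[OF continuous_on_product_coordinates]) auto
  ultimately obtain x where x: "x \<in> S" "\<And>y. y \<in> S \<Longrightarrow> quad_form V A y \<le> quad_form V A x"
    using continuous_attains_sup[OF \<open>compact S\<close>, of "quad_form V A"] by blast
  have "quad_form V A y \<le> quad_form V A x * (\<Sum>v\<in>V. (y v)\<^sup>2)" for y
  proof (cases "\<forall>v\<in>V. y v = 0")
    case True
    then show ?thesis by (simp add: quad_form_def)
  next
    case False
    define s where "s = (\<Sum>v\<in>V. (y v)\<^sup>2)"
    have s: "s > 0"
      using False fin unfolding s_def by (auto intro: sum_pos2)
    let ?z = "\<lambda>v. (1 / sqrt s) * (if v \<in> V then y v else 0)"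
    have "(\<Sum>v\<in>V. (?z v)\<^sup>2) = (\<Sum>v\<in>V. (y v)\<^sup>2 / s)"
      using s by (intro sum.cong) (auto simp: power_mult_distrib power_divide)
    also have "\<dots> = 1" using s by (simp add: s_def flip: sum_divide_distrib)
    finally have "?z \<in> S" by (intro in_S) auto
    then have "quad_form V A ?z \<le> quad_form V A x" by (rule x)
    also have "quad_form V A ?z = quad_form V A y / s"
      unfolding quad_form_scale using s
      by (simp add: power_divide cong: quad_form_cong)
    finally show ?thesis using s by (simp add: s_def field_simps)
  qed
  moreover have "(\<Sum>v\<in>V. (x v)\<^sup>2) = 1" using x(1) by (simp add: S_def)
  ultimately show thesis using that by blast
qed

lemma nonpos_quadratic_linear_coeff_zero:
  fixes b c :: real
  assumes "\<And>t. 2 * t * b + t\<^sup>2 * c \<le> 0"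
  shows "b = 0"
proof (rule ccontr)
  assume b: "b \<noteq> 0"
  \<comment> \<open>At this scale the linear term outweighs the quadratic one, whatever the sign of
    \<open>c\<close>.\<close>
  define t where "t = b / (\<bar>c\<bar> + 1)"
  have tk: "b = t * (\<bar>c\<bar> + 1)" by (simp add: t_def add_nonneg_pos field_simps)
  have "2 * t * b + t\<^sup>2 * c = t\<^sup>2 * (2 * (\<bar>c\<bar> + 1) + c)"
    by (subst tk) (simp add: power2_eq_square algebra_simps)
  moreover have "t \<noteq> 0" using b tk by auto
  moreover have "2 * (\<bar>c\<bar> + 1) + c > 0" by (cases "c \<ge> 0") auto
  ultimately have "2 * t * b + t\<^sup>2 * c > 0" by simp
  with assms[of t] show False by simp
qed

text \<open>First variation: perturbing the maximiser by \<open>t\<close> in coordinate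
  \<open>a\<close> gives a quadratic polynomial in \<open>t\<close> that is never positive, and half
  its linear coefficient is the defect of the eigenvalue equation in row \<open>a\<close>.\<close>

lemma quad_form_max_eigenvector:
  assumes fin: "finite V"
    and sym: "\<And>u v. u \<in> V \<Longrightarrow> v \<in> V \<Longrightarrow> A u v = A v u"
    and eq: "quad_form V A x = l * (\<Sum>v\<in>V. (x v)\<^sup>2)"
    and max: "\<And>y. quad_form V A y \<le> l * (\<Sum>v\<in>V. (y v)\<^sup>2)"
    and a: "a \<in> V"
  shows "(\<Sum>v\<in>V. A a v * x v) = l * x a"
proof -
  let ?e = "\<lambda>v. if v = a then 1 else 0 :: real"
  define b where "b = (\<Sum>v\<in>V. A a v * x v) - l * x a"
  have "2 * t * b + t\<^sup>2 * (A a a - l) \<le> 0" for t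
  proof -
    let ?y = "\<lambda>v. x v + t * ?e v"
    have s: "(\<Sum>v\<in>V. (?y v)\<^sup>2) = (\<Sum>v\<in>V. (x v)\<^sup>2) + 2 * t * x a + t\<^sup>2"
    proof -
      have "(\<Sum>v\<in>V. (?y v)\<^sup>2) = (\<Sum>v\<in>V. (x v)\<^sup>2 + (if v = a then 2 * t * x a + t\<^sup>2 else 0))"
        by (intro sum.cong) (auto simp: power2_eq_square algebra_simps)
      then show ?thesis using fin a by (simp add: sum.distrib)
    qed
    have "quad_form V A ?y = (\<Sum>u\<in>V. \<Sum>v\<in>V. A u v * x u * x v + (if v = a then t * (A u v * x u) else 0)
        + (if u = a then t * (A u v * x v) else 0) + (if u = a then if v = a then t\<^sup>2 * A u v else 0 else 0))"
      unfolding quad_form_def by (intro sum.cong) (auto simp: power2_eq_square algebra_simps)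
    also have "\<dots> = quad_form V A x + (\<Sum>u\<in>V. t * (A u a * x u)) + (\<Sum>v\<in>V. t * (A a v * x v)) + t\<^sup>2 * A a a"
    proof -
      have "(\<Sum>u\<in>V. \<Sum>v\<in>V. if u = a then t * (A u v * x v) else 0) = (\<Sum>u\<in>V. if u = a then \<Sum>v\<in>V. t * (A u v * x v) else 0)"
        by (intro sum.cong) auto
      moreover have "(\<Sum>u\<in>V. \<Sum>v\<in>V. if u = a then if v = a then t\<^sup>2 * A u v else 0 else 0)
          = (\<Sum>u\<in>V. if u = a then \<Sum>v\<in>V. if v = a then t\<^sup>2 * A u v else 0 else 0)"
        by (intro sum.cong) auto
      ultimately show ?thesis
        using fin a by (simp add: quad_form_def sum.distrib)
    qed
    also have "(\<Sum>u\<in>V. t * (A u a * x u)) = (\<Sum>v\<in>V. t * (A a v * x v))"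
      using a sym by (intro sum.cong) auto
    finally have "quad_form V A ?y = quad_form V A x + 2 * t * (\<Sum>v\<in>V. A a v * x v) + t\<^sup>2 * A a a"
      by (simp add: sum_distrib_left mult.assoc)
    with max[of ?y] s eq show ?thesis
      by (simp add: b_def algebra_simps)
  qed
  then have "b = 0" by (rule nonpos_quadratic_linear_coeff_zero)
  then show ?thesis by (simp add: b_def)
qed

text \<open>The variational part of the Perron-Frobenius theorem. Absolute values of a maximiser are
  again a maximiser, hence an eigenvector; one positive entry makes every other row sum positive, so
  no entry vanishes.\<close>

lemma positive_eigenvector:
  assumes fin: "finite V" and card: "2 \<le> card V"
    and sym: "\<And>u v. u \<in> V \<Longrightarrow> v \<in> V \<Longrightarrow> A u v = A v u"
    and nonneg: "\<And>u v. u \<in> V \<Longrightarrow> v \<in> V \<Longrightarrow> 0 \<le> A u v"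
    and pos: "\<And>u v. u \<in> V \<Longrightarrow> v \<in> V \<Longrightarrow> u \<noteq> v \<Longrightarrow> 0 < A u v"
  obtains l x where "\<And>v. v \<in> V \<Longrightarrow> 0 < x v"
    and "\<And>u. u \<in> V \<Longrightarrow> (\<Sum>v\<in>V. A u v * x v) = l * x u"
    and "\<And>y. quad_form V A y \<le> l * (\<Sum>v\<in>V. (y v)\<^sup>2)"
proof -
  have "V \<noteq> {}" using card by auto
  from quad_form_max[OF fin this, of A] obtain z where z: "(\<Sum>v\<in>V. (z v)\<^sup>2) = 1"
    and max: "\<And>y. quad_form V A y \<le> quad_form V A z * (\<Sum>v\<in>V. (y v)\<^sup>2)" by blast
  define l where "l = quad_form V A z"
  define x where "x = (\<lambda>v. \<bar>z v\<bar>)"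
  have "quad_form V A x = l * (\<Sum>v\<in>V. (x v)\<^sup>2)"
    using quad_form_abs_ge[of V A z] nonneg max[of x] z by (simp add: x_def l_def)
  then have ev: "(\<Sum>v\<in>V. A u v * x v) = l * x u" if "u \<in> V" for u
    using quad_form_max_eigenvector[where V = V and A = A and x = x and l = l and a = u] fin sym max that by (simp add: l_def)
  have step: "0 < x u" if uv: "u \<in> V" "v \<in> V" "u \<noteq> v" "0 < x v" for u v
  proof -
    have "0 < (\<Sum>v\<in>V. A u v * x v)"
      using pos[OF uv(1-3)] uv nonneg fin by (intro sum_pos2[of V v]) (auto simp: x_def)
    with ev[OF uv(1)] have "x u \<noteq> 0" by auto
    then show ?thesis by (simp add: x_def)
  qed
  have "\<exists>a\<in>V. z a \<noteq> 0"
  proof (rule ccontr)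
    assume "\<not> ?thesis"
    then have "(\<Sum>v\<in>V. (z v)\<^sup>2) = 0" by simp
    with z show False by simp
  qed
  then obtain a where a: "a \<in> V" "0 < x a" by (auto simp: x_def)
  have "V \<noteq> {a}" using card by auto
  then obtain b where b: "b \<in> V" "b \<noteq> a" using a by blast
  have xb: "0 < x b" using step[OF b(1) a(1) b(2) a(2)] .
  have "0 < x v" if "v \<in> V" for v
    using step[OF that a(1)] a(2) by (cases "v = a") auto
  then show thesis using that ev max unfolding l_def by blast
qed

text \<open>The bridge from functions on vertices to the matrix: \<open>x\<close> makes
  \<open>l\<close> an eigenvalue, and testing the bound on the quadratic form with any other
  eigenvector shows that no eigenvalue exceeds \<open>l\<close>.\<close>

lemma dist_spectral_radius_eqI:
  assumes fin: "finite (verts G)" and l: "\<And>y. quad_form (verts G) (\<lambda>u v. real (graph_dist G u v)) y \<le> l * (\<Sum>v\<in>verts G. (y v)\<^sup>2)"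
    and ev: "\<And>u. u \<in> verts G \<Longrightarrow> (\<Sum>v\<in>verts G. real (graph_dist G u v) * x v) = l * x u"
    and a: "a \<in> verts G" "x a \<noteq> 0"
  shows "dist_spectral_radius G = l"
proof -
  obtain vs where vs: "distinct vs" "set vs = verts G"
    using finite_distinct_list[OF fin] by blast
  define n where "n = length vs"
  let ?D = "dist_matrix G vs"
  have D: "?D \<in> carrier_mat n n" by (simp add: dist_matrix_def n_def)
  have bij: "bij_betw ((!) vs) {..<n} (verts G)"
    using vs by (auto simp: n_def intro!: bij_betw_nth)
  have "l \<in> spectrum ?D"
  proof -
    define w where "w = vec n (\<lambda>i. x (vs ! i))"
    obtain i where i: "i < n" "vs ! i = a" using a vs by (metis in_set_conv_nth n_def)
    then have "w $ i \<noteq> 0" using a by (simp add: w_def)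
    then have "w \<noteq> 0\<^sub>v n" using i by auto
    moreover have "?D *\<^sub>v w = l \<cdot>\<^sub>v w"
    proof (rule eq_vecI)
      fix i assume "i < dim_vec (l \<cdot>\<^sub>v w)"
      then have i: "i < n" by (simp add: w_def)
      have "(?D *\<^sub>v w) $ i = (\<Sum>j<n. real (graph_dist G (vs ! i) (vs ! j)) * x (vs ! j))"
        using i by (simp add: dist_matrix_def scalar_prod_def w_def n_def lessThan_atLeast0)
      also have "\<dots> = (\<Sum>v\<in>verts G. real (graph_dist G (vs ! i) v) * x v)"
        by (rule sum.reindex_bij_betw[OF bij])
      also have "\<dots> = l * x (vs ! i)"
        using nth_mem[of i vs] i vs(2) by (intro ev) (simp add: n_def)
      finally show "(?D *\<^sub>v w) $ i = (l \<cdot>\<^sub>v w) $ i" using i by (simp add: w_def)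
    qed (simp add: dist_matrix_def w_def n_def)
    ultimately have "eigenvector ?D w l" using D by (simp add: eigenvector_def w_def)
    then show ?thesis by (auto simp: spectrum_def eigenvalue_def)
  qed
  moreover have "m \<le> l" if m: "m \<in> spectrum ?D" for m
  proof -
    obtain w where w: "w \<in> carrier_vec n" "w \<noteq> 0\<^sub>v n" "?D *\<^sub>v w = m \<cdot>\<^sub>v w"
      using m D by (auto simp: spectrum_def eigenvalue_def eigenvector_def)
    define y where "y = (\<lambda>v. w $ the_inv_into {..<n} ((!) vs) v)"
    have y: "y (vs ! i) = w $ i" if "i < n" for i
      using bij that unfolding y_def by (subst the_inv_into_f_f) (auto simp: bij_betw_def)
    have row: "(\<Sum>j<n. real (graph_dist G (vs ! i) (vs ! j)) * w $ j) = m * w $ i" if "i < n" for i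
      using arg_cong[OF w(3), of "\<lambda>u. u $ i"] that w(1)
      by (auto simp: dist_matrix_def scalar_prod_def n_def lessThan_atLeast0)
    have "quad_form (verts G) (\<lambda>u v. real (graph_dist G u v)) y
        = (\<Sum>i<n. \<Sum>j<n. real (graph_dist G (vs ! i) (vs ! j)) * y (vs ! i) * y (vs ! j))"
      unfolding quad_form_def by (simp flip: sum.reindex_bij_betw[OF bij])
    also have "\<dots> = (\<Sum>i<n. w $ i * (\<Sum>j<n. real (graph_dist G (vs ! i) (vs ! j)) * w $ j))"
      by (simp add: y sum_distrib_left ac_simps)
    also have "\<dots> = m * (\<Sum>i<n. (w $ i)\<^sup>2)"
      unfolding sum_distrib_left[of m] by (intro sum.cong) (simp_all add: row power2_eq_square)
    finally have "m * (\<Sum>i<n. (w $ i)\<^sup>2) \<le> l * (\<Sum>v\<in>verts G. (y v)\<^sup>2)" using l[of y] by simp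
    also have "(\<Sum>v\<in>verts G. (y v)\<^sup>2) = (\<Sum>i<n. (w $ i)\<^sup>2)"
      by (simp add: y flip: sum.reindex_bij_betw[OF bij])
    finally have le: "m * (\<Sum>i<n. (w $ i)\<^sup>2) \<le> l * (\<Sum>i<n. (w $ i)\<^sup>2)" .
    have "\<exists>i<n. w $ i \<noteq> 0"
    proof (rule ccontr)
      assume "\<not> ?thesis"
      then have "w = 0\<^sub>v n" using w(1) by (intro eq_vecI) auto
      with w(2) show False by simp
    qed
    then have "0 < (\<Sum>i<n. (w $ i)\<^sup>2)" by (auto intro: sum_pos2)
    with le show ?thesis by (simp add: mult_le_cancel_right)
  qed
  moreover have "finite (spectrum ?D)" using card_finite_spectrum[OF D] by simp
  ultimately have "Max (spectrum ?D) = l" by (intro Max_eqI) auto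
  then show ?thesis using vs by (subst dist_spectral_radius_eq) (auto simp: vertex_enum_def)
qed

section \<open>Distances in trees\<close>

text \<open>Distance expressed by powers of the edge relation: it ignores the names of arcs, suits
  induction on the length, and transfers along injective maps.\<close>

definition reldist :: "('a \<times> 'a) set \<Rightarrow> 'a \<Rightarrow> 'a \<Rightarrow> nat" where
  "reldist E u v = (LEAST l. (u, v) \<in> E ^^ l)"

lemma reldist_le: "(u, v) \<in> E ^^ l \<Longrightarrow> reldist E u v \<le> l"
  unfolding reldist_def by (rule Least_le)

lemma relpow_reldist:
  assumes "(u, v) \<in> E\<^sup>*"
  shows "(u, v) \<in> E ^^ reldist E u v"
  using assms LeastI_ex[of "\<lambda>l. (u, v) \<in> E ^^ l"] by (simp add: reldist_def rtrancl_power)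

lemma relpow_sym:
  assumes "sym E" "(u, v) \<in> E ^^ l"
  shows "(v, u) \<in> E ^^ l"
  using assms(2)
proof (induction l arbitrary: v)
  case (Suc l)
  then obtain a where "(a, u) \<in> E ^^ l" "(a, v) \<in> E" by auto
  with assms(1) show ?case by (intro relpow_Suc_I2) (auto dest: symD)
qed simp

lemma reldist_commute:
  assumes "sym E"
  shows "reldist E u v = reldist E v u"
  using relpow_sym[OF assms] unfolding reldist_def by metis

lemma reldist_map:
  assumes "inj_on f V" "E \<subseteq> V \<times> V" "u \<in> V" "v \<in> V"
  shows "reldist (map_prod f f ` E) (f u) (f v) = reldist E u v"
proof -
  have "(f u, f v) \<in> (map_prod f f ` E) ^^ l \<longleftrightarrow> (u, v) \<in> E ^^ l" if "v \<in> V" for l v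
    using that
  proof (induction l arbitrary: v)
    case 0
    then show ?case using assms by (auto dest: inj_onD)
  next
    case (Suc l)
    show ?case
    proof
      assume "(f u, f v) \<in> (map_prod f f ` E) ^^ Suc l"
      then obtain a b where ab: "(a, b) \<in> E" "(f u, f a) \<in> (map_prod f f ` E) ^^ l" "f b = f v"
        by auto
      then have "b = v" using assms Suc.prems by (auto dest: inj_onD)
      then show "(u, v) \<in> E ^^ Suc l" using ab Suc.IH[of a] assms(2) by auto
    next
      assume "(u, v) \<in> E ^^ Suc l"
      then obtain a where a: "(u, a) \<in> E ^^ l" "(a, v) \<in> E" by auto
      then have "(f u, f a) \<in> (map_prod f f ` E) ^^ l" using Suc.IH[of a] assms(2) by auto
      then show "(f u, f v) \<in> (map_prod f f ` E) ^^ Suc l" using a(2) by force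
    qed
  qed
  then show ?thesis using assms(4) unfolding reldist_def by simp
qed

text \<open>The source of the lower bounds on distances between vertices of different index or
  height.\<close>

lemma relpow_Lipschitz:
  fixes g :: "'a \<Rightarrow> int"
  assumes "\<And>u v. (u, v) \<in> E \<Longrightarrow> \<bar>g u - g v\<bar> \<le> 1" and "(u, v) \<in> E ^^ l"
  shows "\<bar>g u - g v\<bar> \<le> int l"
  using assms(2)
proof (induction l arbitrary: v)
  case (Suc l)
  then obtain a where "(u, a) \<in> E ^^ l" "(a, v) \<in> E" by auto
  with Suc.IH[of a] assms(1)[of a v] show ?case by simp
qed simp

section \<open>Walks, paths and powers of the edge relation\<close>

context wf_digraph
begin

lemma awalk_imp_relpow: "awalk u p v \<Longrightarrow> (u, v) \<in> arcs_ends G ^^ length p"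
proof (induction p arbitrary: u)
  case (Cons e es)
  then have "e \<in> arcs G" "u = tail G e" "(head G e, v) \<in> arcs_ends G ^^ length es"
    by (auto simp: awalk_Cons_iff)
  moreover from this have "(u, head G e) \<in> arcs_ends G" by (auto simp: arcs_ends_conv)
  ultimately show ?case using relpow_Suc_I2[of u "head G e" "arcs_ends G" v "length es"] by simp
qed (auto simp: awalk_Nil_iff)

text \<open>The subrelation \<open>R\<close> confines the walk to chosen edges, as
  \<open>tree_edge_in_spanning_set\<close> requires; for distances, \<open>R\<close> is the whole
  edge relation.\<close>

lemma relpow_imp_awalk:
  assumes "u \<in> verts G" "(u, v) \<in> R ^^ l" "R \<subseteq> arcs_ends G"
  shows "\<exists>p. awalk u p v \<and> length p = l \<and> arc_to_ends G ` set p \<subseteq> R"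
  using assms(1,2)
proof (induction l arbitrary: u)
  case 0
  then show ?case by (auto simp: awalk_Nil_iff)
next
  case (Suc l)
  then obtain a where a: "(u, a) \<in> R" "(a, v) \<in> R ^^ l" by (metis relpow_Suc_D2)
  then obtain e where e: "e \<in> arcs G" "arc_to_ends G e = (u, a)"
    using assms(3) by (auto simp: arcs_ends_def)
  then have "a \<in> verts G" by (auto simp: arc_to_ends_def)
  with Suc.IH[of a] a obtain p where "awalk a p v" "length p = l" "arc_to_ends G ` set p \<subseteq> R"
    by auto
  with e a show ?case
    by (intro exI[of _ "e # p"]) (auto simp: awalk_Cons_iff arc_to_ends_def)
qed

text \<open>Closed subwalks are cut out one by one. The length bound serves distances, the inclusion
  of arc sets serves \<open>tree_edge_in_spanning_set\<close>.\<close>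

lemma awalk_imp_short_apath:
  assumes "awalk u p v"
  shows "\<exists>q. apath u q v \<and> set q \<subseteq> set p \<and> length q \<le> length p"
  using assms
proof (induction rule: awalk_to_apath_induct)
  case (path p)
  then show ?case by (auto simp: apath_def)
next
  case (decomp p q r s)
  then have "p = q @ r @ s" using awalk_cyc_decompE by blast
  then show ?case using decomp.IH by fastforce
qed

lemma graph_dist_eq_reldist:
  assumes u: "u \<in> verts G" and uv: "(u, v) \<in> (arcs_ends G)\<^sup>*"
  shows "graph_dist G u v = reldist (arcs_ends G) u v"
  unfolding graph_dist_def
proof (rule Least_equality)
  from relpow_imp_awalk[OF u relpow_reldist[OF uv]] obtain p where
    p: "awalk u p v" "length p = reldist (arcs_ends G) u v" by auto
  then obtain q where q: "apath u q v" "length q \<le> length p"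
    using awalk_imp_short_apath by blast
  moreover have "reldist (arcs_ends G) u v \<le> length q"
    using q by (auto simp: apath_def intro!: reldist_le awalk_imp_relpow)
  ultimately show "\<exists>p. apath u p v \<and> length p = reldist (arcs_ends G) u v" using p by force
next
  fix l assume "\<exists>p. apath u p v \<and> length p = l"
  then show "reldist (arcs_ends G) u v \<le> l"
    by (auto simp: apath_def intro!: reldist_le awalk_imp_relpow)
qed

end

text \<open>Positions start at 1 in the injectivity claim because the first and the last vertex of
  the closed walk coincide.\<close>

lemma (in wf_digraph) cycle_vertices:
  assumes "cycle p"
  obtains f where "f 0 = f (length p)" "inj_on f {1..length p}"
    "\<And>i. i < length p \<Longrightarrow> (f i, f (Suc i)) \<in> arcs_ends G"
proof -
  obtain u where u: "awalk u p u" "distinct (tl (awalk_verts u p))" and ne: "p \<noteq> []"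
    using assms by (auto simp: cycle_def)
  define f where "f i = awalk_verts u p ! i" for i
  have cas: "cas u p u" using u(1) by (simp add: awalk_def)
  have head: "f (Suc i) = head G (p ! i)" if "i < length p" for i
    using that ne by (simp add: f_def awalk_verts_conv'[OF cas])
  have tail: "f i = tail G (p ! i)" if "i < length p" for i
    using that ne by (simp add: f_def awalk_verts_conv nth_append)
  have "f 0 = hd (awalk_verts u p)" by (simp add: f_def hd_conv_nth)
  moreover have "f (length p) = last (awalk_verts u p)"
    by (simp add: f_def last_conv_nth length_awalk_verts)
  ultimately have "f 0 = f (length p)" using u(1) by simp
  moreover have "inj_on f {1..length p}"
  proof
    fix i j assume ij: "i \<in> {1..length p}" "j \<in> {1..length p}" "f i = f j"
    have nth: "f k = tl (awalk_verts u p) ! (k - 1)" if "k \<in> {1..length p}" for k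
      using that by (cases k) (auto simp: f_def nth_tl length_awalk_verts)
    have "i - 1 = j - 1"
      using ij nth[of i] nth[of j] nth_eq_iff_index_eq[OF u(2), of "i - 1" "j - 1"]
      by (auto simp: length_awalk_verts)
    then show "i = j" using ij by auto
  qed
  moreover have "(f i, f (Suc i)) \<in> arcs_ends G" if "i < length p" for i
  proof -
    have "p ! i \<in> arcs G" using u(1) that by (auto simp: awalk_def)
    then show ?thesis using head[OF that] tail[OF that] by (auto simp: arcs_ends_conv)
  qed
  ultimately show thesis by (rule that)
qed

text \<open>An arc together with a path between its ends avoiding it would close up to a cycle, so a
  connected spanning set of edges of a tree contains all edges.\<close>

lemma tree_edge_in_spanning_set:
  assumes T: "undirected_tree T" and H: "H \<subseteq> arcs_ends T"
    and ab: "(a, b) \<in> arcs_ends T" and ba: "(b, a) \<in> H\<^sup>*"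
  shows "(b, a) \<in> H"
proof -
  interpret graph T using T by (simp add: undirected_tree_def)
  obtain e where e: "e \<in> arcs T" "tail T e = a" "head T e = b"
    using ab by (auto simp: arcs_ends_conv)
  then have ne: "a \<noteq> b" using no_loops by auto
  obtain l where "(b, a) \<in> H ^^ l" using ba by (auto simp: rtrancl_power)
  then obtain p where p: "awalk b p a" "arc_to_ends T ` set p \<subseteq> H"
    using relpow_imp_awalk[of b a l H] e H by auto
  then obtain q where q: "apath b q a" "set q \<subseteq> set p" using awalk_imp_short_apath by blast
  have "awalk a (e # q) a" using e q by (auto simp: awalk_Cons_iff apath_def)
  moreover have "distinct (tl (awalk_verts a (e # q)))" using e q by (auto simp: apath_def)
  ultimately have "cycle (e # q)" unfolding cycle_def by blast
  \<comment> \<open>Only a cycle of length 2 is allowed, so \<open>q\<close> is a single arc from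
    \<open>b\<close> to \<open>a\<close>; being taken from \<open>p\<close>, it lies over
    \<open>H\<close>.\<close>
  then have "\<not> 3 \<le> length (e # q)" using T unfolding undirected_tree_def by blast
  moreover have "q \<noteq> []" using q ne by (auto simp: apath_def awalk_Nil_iff)
  ultimately have "length q = 1" by (cases q) (auto simp: numeral_eq_Suc Suc_le_eq)
  then obtain f where "q = [f]" by (auto simp: length_Suc_conv)
  then have "f \<in> set p" "arc_to_ends T f = (b, a)"
    using q by (auto simp: apath_def awalk_simps arc_to_ends_def)
  then show ?thesis using p by force
qed

lemma undirected_tree_connected:
  assumes T: "undirected_tree T" and "u \<in> verts T" "v \<in> verts T"
  shows "(u, v) \<in> (arcs_ends T)\<^sup>*"
proof -
  interpret graph T using T by (simp add: undirected_tree_def)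
  have "strongly_connected T"
    using T sym_arcs by (intro symmetric_connected_imp_strongly_connected) (auto simp: undirected_tree_def)
  then have "u \<rightarrow>\<^sup>*\<^bsub>T\<^esub> v" using assms by (auto simp: strongly_connected_def)
  then show ?thesis by (rule reachable_rtranclI)
qed

lemma undirected_tree_dist:
  assumes T: "undirected_tree T" and "u \<in> verts T" "v \<in> verts T"
  shows "graph_dist T u v = reldist (arcs_ends T) u v"
proof -
  interpret graph T using T by (simp add: undirected_tree_def)
  show ?thesis using assms undirected_tree_connected by (intro graph_dist_eq_reldist) auto
qed

section \<open>Trees hanging off a path\<close>

lemma image_atMost_reflect: "(\<lambda>j::nat. p (d - j)) ` {..d} = p ` {..d}"
proof (safe, goal_cases)
  case (2 _ j)
  then show ?case by (intro image_eqI[of _ _ "d - j"]) auto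
qed auto

text \<open>A graph is seen as a path \<open>p 0, \<dots>, p d\<close> with rooted trees hanging off it: \<open>par\<close> is the
  parent of a vertex off the path, \<open>ht\<close> its height above the path, and \<open>p (idx v)\<close> is the
  vertex of the path from which \<open>v\<close> hangs.\<close>

locale spine =
  fixes V :: "'a set" and E :: "('a \<times> 'a) set" and d :: nat
    and p :: "nat \<Rightarrow> 'a" and idx ht :: "'a \<Rightarrow> nat" and par :: "'a \<Rightarrow> 'a"
  assumes fin: "finite V"
    and E_V: "E \<subseteq> V \<times> V" and sym_E: "sym E"
    and p_V: "j \<le> d \<Longrightarrow> p j \<in> V"
    and idx_p: "j \<le> d \<Longrightarrow> idx (p j) = j"
    and ht_0: "v \<in> V \<Longrightarrow> ht v = 0 \<longleftrightarrow> v \<in> p ` {..d}"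
    and idx_le: "v \<in> V \<Longrightarrow> idx v \<le> d"
    and par_V: "v \<in> V \<Longrightarrow> 0 < ht v \<Longrightarrow> par v \<in> V"
    and ht_par: "v \<in> V \<Longrightarrow> 0 < ht v \<Longrightarrow> Suc (ht (par v)) = ht v"
    and idx_par: "v \<in> V \<Longrightarrow> 0 < ht v \<Longrightarrow> idx (par v) = idx v"
    and par_E: "v \<in> V \<Longrightarrow> 0 < ht v \<Longrightarrow> (v, par v) \<in> E"
    and path_E: "j < d \<Longrightarrow> (p j, p (Suc j)) \<in> E"
    and E_cases: "(u, v) \<in> E \<Longrightarrow> (\<exists>j<d. (u, v) = (p j, p (Suc j)) \<or> (v, u) = (p j, p (Suc j)))
          \<or> 0 < ht u \<and> v = par u \<or> 0 < ht v \<and> u = par v"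
begin

lemma ht_p [simp]: "j \<le> d \<Longrightarrow> ht (p j) = 0"
  using ht_0 p_V by blast

lemma inj_p: "inj_on p {..d}"
  by (rule inj_on_inverseI[of _ idx]) (simp add: idx_p)

text \<open>This allows the path to be oriented so that its left half carries at least half of the
  hanging vertices.\<close>

lemma spine_reverse: "spine V E d (\<lambda>j. p (d - j)) (\<lambda>v. d - idx v) ht par"
proof
  fix v assume v: "v \<in> V"
  show "ht v = 0 \<longleftrightarrow> v \<in> (\<lambda>j. p (d - j)) ` {..d}"
    using ht_0[OF v] by (simp only: image_atMost_reflect)
next
  fix j assume j: "j < d"
  then have "(p (d - Suc j), p (Suc (d - Suc j))) \<in> E" by (intro path_E) auto
  then show "(p (d - j), p (d - Suc j)) \<in> E" using j sym_E by (simp add: Suc_diff_Suc symD)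
next
  fix u v assume "(u, v) \<in> E"
  have "(\<exists>j<d. (u, v) = (p j, p (Suc j))) \<Longrightarrow> (\<exists>j<d. (v, u) = (p (d - j), p (d - Suc j)))" for u v
    by (metis Suc_diff_Suc diff_Suc_less diff_diff_cancel less_imp_le_nat prod.inject zero_less_Suc
        Suc_leI diff_less_mono2 diff_less zero_less_iff_neq_zero not_less_zero)
  with E_cases[OF \<open>(u, v) \<in> E\<close>]
  show "(\<exists>j<d. (u, v) = (p (d - j), p (d - Suc j)) \<or> (v, u) = (p (d - j), p (d - Suc j)))
      \<or> 0 < ht u \<and> v = par u \<or> 0 < ht v \<and> u = par v"
    by metis
qed (auto simp: fin sym_E p_V idx_p par_V ht_par idx_par par_E dest: subsetD[OF E_V])

lemma E_ends: "(u, v) \<in> E \<Longrightarrow> u \<in> V \<and> v \<in> V"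
  using E_V by auto

lemma dist_idx_ge:
  assumes V: "u \<in> V" "v \<in> V" and ne: "idx u < idx v" and l: "(u, v) \<in> E ^^ l"
  shows "ht u + ht v + (idx v - idx u) \<le> l"
proof -
  \<comment> \<open>A coordinate on a line: heights count forwards beyond the index of
    \<open>u\<close> and backwards up to it. The sign changes only across a path edge, where both
    heights are 0, so \<open>?g\<close> still changes by at most 1 along every edge, and
    \<open>?g v - ?g u\<close> is the claimed distance.\<close>
  let ?g = "\<lambda>z. int (idx z) + (if idx u < idx z then int (ht z) else - int (ht z))"
  have "\<bar>?g a - ?g b\<bar> \<le> 1" if "(a, b) \<in> E" for a b
    using E_cases[OF that] E_ends[OF that] ht_par[of a] ht_par[of b] idx_par[of a] idx_par[of b]
    by (auto simp: idx_p)
  from relpow_Lipschitz[of E ?g, OF this l] ne show ?thesis by simp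
qed

lemma dist_ht_ge:
  assumes l: "(u, v) \<in> E ^^ l"
  shows "ht u \<le> l + ht v"
proof -
  have "\<bar>int (ht a) - int (ht b)\<bar> \<le> 1" if "(a, b) \<in> E" for a b
    using E_cases[OF that] E_ends[OF that] ht_par[of a] ht_par[of b] by auto
  from relpow_Lipschitz[of E "\<lambda>v. int (ht v)", OF this l] show ?thesis by simp
qed

lemma rtrancl_p: "j \<le> d \<Longrightarrow> (p j, p 0) \<in> E\<^sup>*"
proof (induction j)
  case (Suc j)
  then have "(p (Suc j), p j) \<in> E" using path_E[of j] sym_E by (auto dest: symD)
  with Suc show ?case by auto
qed simp

lemma rtrancl_p0:
  assumes "v \<in> V"
  shows "(v, p 0) \<in> E\<^sup>*"
  using assms
proof (induction "ht v" arbitrary: v)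
  case 0
  then show ?case using ht_0 rtrancl_p by auto
next
  case (Suc k)
  then have "(par v, p 0) \<in> E\<^sup>*" using ht_par[of v] par_V[of v] by auto
  moreover have "(v, par v) \<in> E" using Suc by (intro par_E) auto
  ultimately show ?case by auto
qed

lemma rtrancl_V:
  assumes "u \<in> V" "v \<in> V"
  shows "(u, v) \<in> E\<^sup>*"
  using rtrancl_p0[OF assms(1)] rtrancl_p0[OF assms(2)] sym_rtrancl[OF sym_E]
  by (meson symD rtrancl_trans)

abbreviation dist where "dist \<equiv> reldist E"

lemma dist_ge:
  assumes "u \<in> V" "v \<in> V" "idx u \<noteq> idx v"
  shows "int (ht u) + int (ht v) + \<bar>int (idx u) - int (idx v)\<bar> \<le> int (dist u v)"
proof -
  have l: "(u, v) \<in> E ^^ dist u v" "(v, u) \<in> E ^^ dist v u"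
    using assms rtrancl_V by (auto intro: relpow_reldist)
  show ?thesis
  proof (cases "idx u < idx v")
    case True
    then show ?thesis using dist_idx_ge[OF assms(1,2) _ l(1)] by simp
  next
    case False
    then show ?thesis using dist_idx_ge[OF assms(2,1) _ l(2)] assms reldist_commute[OF sym_E, of u v]
      by simp
  qed
qed

text \<open>If \<open>v\<close> hangs from \<open>p j\<close> itself, the index difference vanishes
  and the height alone gives the bound.\<close>

lemma dist_p_ge:
  assumes "v \<in> V" "j \<le> d"
  shows "int (ht v) + \<bar>int (idx v) - int j\<bar> \<le> int (dist v (p j))"
proof (cases "idx v = j")
  case True
  have "(v, p j) \<in> E ^^ dist v (p j)" using assms p_V rtrancl_V by (auto intro: relpow_reldist)
  from dist_ht_ge[OF this] show ?thesis using True assms by simp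
next
  case False
  then show ?thesis using dist_ge[of v "p j"] assms p_V by (simp add: idx_p)
qed

section \<open>Vertices off the path and their share of the quadratic form\<close>

definition off :: "'a set" where "off = V - p ` {..d}"

lemma off_iff: "v \<in> off \<longleftrightarrow> v \<in> V \<and> 0 < ht v"
  using ht_0 by (auto simp: off_def)

lemma fin_off: "finite off"
  using fin by (simp add: off_def)

lemma card_off: "card V = Suc d + card off"
proof -
  have "card (p ` {..d}) = Suc d" using inj_p by (simp add: card_image)
  moreover have "p ` {..d} \<subseteq> V" using p_V by auto
  ultimately show ?thesis
    using fin unfolding off_def by (metis card_Diff_subset card_mono finite_subset le_add_diff_inverse)
qed

text \<open>Only height 1 of each vertex is counted. The edge term is the loss for adjacent
  vertices, whose total \<open>count_off_edges\<close> bounds by the excess heights.\<close>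

lemma dist_off_ge:
  assumes "u \<in> off" "v \<in> off" "u \<noteq> v"
  shows "2 + \<bar>int (idx u) - int (idx v)\<bar> - of_bool ((u, v) \<in> E) \<le> int (dist u v)"
proof (cases "idx u = idx v")
  case False
  then show ?thesis using dist_ge[of u v] assms by (auto simp: off_iff)
next
  case True
  have l: "(u, v) \<in> E ^^ dist u v" using assms rtrancl_V by (auto simp: off_iff intro: relpow_reldist)
  have "dist u v \<noteq> 0" using l assms by (intro notI) auto
  moreover have "dist u v = 1 \<Longrightarrow> (u, v) \<in> E" using l by auto
  ultimately show ?thesis using True by (cases "dist u v = 1") auto
qed

text \<open>An edge between two vertices off the path joins a vertex of height at least two to its
  parent.\<close>

lemma count_off_edges:
  "(\<Sum>u\<in>off. \<Sum>v\<in>off. of_bool ((u, v) \<in> E) :: int) \<le> 2 * (\<Sum>w\<in>off. int (ht w) - 1)"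
proof -
  let ?P = "\<lambda>u v. v = par u \<and> 2 \<le> ht u"
  have "(of_bool ((u, v) \<in> E) :: int) \<le> of_bool (?P u v) + of_bool (?P v u)"
    if "u \<in> off" "v \<in> off" for u v
  proof (cases "(u, v) \<in> E")
    case True
    then show ?thesis using E_cases[OF True] that ht_par[of u] ht_par[of v] by (auto simp: off_iff)
  qed simp
  then have "(\<Sum>u\<in>off. \<Sum>v\<in>off. of_bool ((u, v) \<in> E) :: int)
      \<le> (\<Sum>u\<in>off. \<Sum>v\<in>off. of_bool (?P u v) + of_bool (?P v u))"
    by (intro sum_mono) auto
  also have "\<dots> = 2 * (\<Sum>u\<in>off. \<Sum>v\<in>off. of_bool (?P u v))"
    using sum.swap[of "\<lambda>u v. of_bool (?P v u) :: int" off off] by (simp add: sum.distrib)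
  \<comment> \<open>A vertex has a single parent, so its inner sum is at most
    \<open>of_bool (2 \<le> ht u)\<close>.\<close>
  also have "(\<Sum>u\<in>off. \<Sum>v\<in>off. of_bool (?P u v) :: int) \<le> (\<Sum>u\<in>off. int (ht u) - 1)"
  proof (rule sum_mono)
    fix u assume u: "u \<in> off"
    have "(\<Sum>v\<in>off. of_bool (?P u v) :: int) = (\<Sum>v\<in>off. if v = par u then of_bool (2 \<le> ht u) else 0)"
      by (intro sum.cong) auto
    also have "\<dots> \<le> int (ht u) - 1" using fin_off u by (auto simp: off_iff)
    finally show "(\<Sum>v\<in>off. of_bool (?P u v)) \<le> int (ht u) - 1" .
  qed
  finally show ?thesis by simp
qed

text \<open>The block decomposition into path and off-path vertices. It serves both for the
  transplanted vector in an arbitrary tree and for the exact value in the extremal tree.\<close>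

lemma quad_form_split:
  fixes y :: real and \<xi> :: "nat \<Rightarrow> real" and D :: "'a \<Rightarrow> 'a \<Rightarrow> real"
  assumes "\<And>u v. D u v = D v u"
  defines "z \<equiv> \<lambda>v. if v \<in> p ` {..d} then \<xi> (idx v) else y"
  shows "(\<Sum>u\<in>V. \<Sum>v\<in>V. D u v * z u * z v)
     = (\<Sum>i\<le>d. \<Sum>j\<le>d. D (p i) (p j) * \<xi> i * \<xi> j)
       + 2 * y * (\<Sum>w\<in>off. \<Sum>j\<le>d. D w (p j) * \<xi> j) + y\<^sup>2 * (\<Sum>u\<in>off. \<Sum>v\<in>off. D u v)"
    and "(\<Sum>v\<in>V. (z v)\<^sup>2) = (\<Sum>j\<le>d. (\<xi> j)\<^sup>2) + real (card off) * y\<^sup>2"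
proof -
  have split: "sum f V = (\<Sum>j\<le>d. f (p j)) + sum f off" for f :: "'a \<Rightarrow> real"
  proof -
    have "sum f V = sum f off + sum f (p ` {..d})"
      unfolding off_def using fin p_V by (intro sum.subset_diff) auto
    then show ?thesis by (simp add: sum.reindex[OF inj_p])
  qed
  have z: "z (p j) = \<xi> j" if "j \<le> d" for j using that by (auto simp: z_def idx_p)
  have z': "z v = y" if "v \<in> off" for v using that by (auto simp: z_def off_def)
  have "(\<Sum>j\<le>d. \<Sum>w\<in>off. D (p j) w * \<xi> j * y) = (\<Sum>w\<in>off. \<Sum>j\<le>d. D w (p j) * \<xi> j * y)"
    by (subst sum.swap) (simp add: assms(1)[of "p _"])
  then show "(\<Sum>u\<in>V. \<Sum>v\<in>V. D u v * z u * z v)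
     = (\<Sum>i\<le>d. \<Sum>j\<le>d. D (p i) (p j) * \<xi> i * \<xi> j)
       + 2 * y * (\<Sum>w\<in>off. \<Sum>j\<le>d. D w (p j) * \<xi> j) + y\<^sup>2 * (\<Sum>u\<in>off. \<Sum>v\<in>off. D u v)"
    by (simp add: split z z' sum.distrib sum_distrib_left power2_eq_square ac_simps)
  show "(\<Sum>v\<in>V. (z v)\<^sup>2) = (\<Sum>j\<le>d. (\<xi> j)\<^sup>2) + real (card off) * y\<^sup>2"
    by (simp add: split z z')
qed

text \<open>If all heights are 1 and all indices are the centre, the lower bound is the exact
  quadratic form of the extremal tree. The comparison therefore loses nothing in the equality
  case.\<close>

lemma quad_form_dist_ge:
  assumes \<xi>: "\<And>j. j \<le> d \<Longrightarrow> 0 \<le> \<xi> j" and y: "0 \<le> (y :: real)"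
  defines "z \<equiv> \<lambda>v. if v \<in> p ` {..d} then \<xi> (idx v) else y"
  shows "(\<Sum>i\<le>d. \<Sum>j\<le>d. \<bar>real i - real j\<bar> * \<xi> i * \<xi> j)
     + 2 * y * (\<Sum>w\<in>off. \<Sum>j\<le>d. (real (ht w) + \<bar>real (idx w) - real j\<bar>) * \<xi> j)
     + y\<^sup>2 * (2 * real (card off) * (real (card off) - 1)
        + (\<Sum>u\<in>off. \<Sum>v\<in>off. \<bar>real (idx u) - real (idx v)\<bar>) - 2 * (\<Sum>w\<in>off. real (ht w) - 1))
     \<le> (\<Sum>u\<in>V. \<Sum>v\<in>V. real (dist u v) * z u * z v)"
proof -
  have dp: "real (ht v) + \<bar>real (idx v) - real j\<bar> \<le> real (dist v (p j))" if "v \<in> V" "j \<le> d" for v j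
    using dist_p_ge[OF that] by linarith
  have "(\<Sum>i\<le>d. \<Sum>j\<le>d. \<bar>real i - real j\<bar> * \<xi> i * \<xi> j)
      \<le> (\<Sum>i\<le>d. \<Sum>j\<le>d. real (dist (p i) (p j)) * \<xi> i * \<xi> j)"
  proof (intro sum_mono mult_right_mono)
    fix i j assume "i \<in> {..d}" "j \<in> {..d}"
    then show "\<bar>real i - real j\<bar> \<le> real (dist (p i) (p j))"
      using dp[of "p i" j] p_V by (simp add: idx_p)
  qed (use \<xi> in auto)
  moreover have "(\<Sum>w\<in>off. \<Sum>j\<le>d. (real (ht w) + \<bar>real (idx w) - real j\<bar>) * \<xi> j)
      \<le> (\<Sum>w\<in>off. \<Sum>j\<le>d. real (dist w (p j)) * \<xi> j)"
    using \<xi> dp by (intro sum_mono mult_right_mono) (auto simp: off_iff)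
  then have "2 * y * (\<Sum>w\<in>off. \<Sum>j\<le>d. (real (ht w) + \<bar>real (idx w) - real j\<bar>) * \<xi> j)
      \<le> 2 * y * (\<Sum>w\<in>off. \<Sum>j\<le>d. real (dist w (p j)) * \<xi> j)"
    using y by (intro mult_left_mono) auto
  moreover have "2 * real (card off) * (real (card off) - 1)
        + (\<Sum>u\<in>off. \<Sum>v\<in>off. \<bar>real (idx u) - real (idx v)\<bar>) - 2 * (\<Sum>w\<in>off. real (ht w) - 1)
      \<le> (\<Sum>u\<in>off. \<Sum>v\<in>off. real (dist u v))"
  proof -
    have "(\<Sum>u\<in>off. \<Sum>v\<in>off. 2 - (if v = u then 2 else 0) + \<bar>real (idx u) - real (idx v)\<bar> - of_bool ((u, v) \<in> E))
        \<le> (\<Sum>u\<in>off. \<Sum>v\<in>off. real (dist u v))"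
    proof (intro sum_mono)
      fix u v assume uv: "u \<in> off" "v \<in> off"
      show "2 - (if v = u then 2 else 0) + \<bar>real (idx u) - real (idx v)\<bar> - of_bool ((u, v) \<in> E) \<le> real (dist u v)"
      proof (cases "u = v")
        case False
        have "real_of_int (2 + \<bar>int (idx u) - int (idx v)\<bar> - of_bool ((u, v) \<in> E))
            \<le> real_of_int (int (dist u v))"
          using dist_off_ge[OF uv False] by (simp only: of_int_le_iff)
        then show ?thesis using False by simp
      qed simp
    qed
    moreover have "(\<Sum>u\<in>off. \<Sum>v\<in>off. 2 - (if v = u then 2 else 0) + \<bar>real (idx u) - real (idx v)\<bar> - of_bool ((u, v) \<in> E))
        = 2 * real (card off) * (real (card off) - 1) + (\<Sum>u\<in>off. \<Sum>v\<in>off. \<bar>real (idx u) - real (idx v)\<bar>)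
          - (\<Sum>u\<in>off. \<Sum>v\<in>off. of_bool ((u, v) \<in> E))"
      using fin_off by (simp add: sum.distrib sum_subtractf algebra_simps)
    moreover have "(\<Sum>u\<in>off. \<Sum>v\<in>off. of_bool ((u, v) \<in> E) :: real) \<le> 2 * (\<Sum>w\<in>off. real (ht w) - 1)"
    proof -
      have "real_of_int (\<Sum>u\<in>off. \<Sum>v\<in>off. of_bool ((u, v) \<in> E)) \<le> real_of_int (2 * (\<Sum>w\<in>off. int (ht w) - 1))"
        using count_off_edges by (simp only: of_int_le_iff)
      then show ?thesis by simp
    qed
    ultimately show ?thesis by linarith
  qed
  then have "y\<^sup>2 * (2 * real (card off) * (real (card off) - 1)
        + (\<Sum>u\<in>off. \<Sum>v\<in>off. \<bar>real (idx u) - real (idx v)\<bar>) - 2 * (\<Sum>w\<in>off. real (ht w) - 1))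
      \<le> y\<^sup>2 * (\<Sum>u\<in>off. \<Sum>v\<in>off. real (dist u v))"
    by (rule mult_left_mono) simp
  ultimately show ?thesis
    using quad_form_split(1)[of "\<lambda>u v. real (dist u v)" \<xi> y] reldist_commute[OF sym_E]
    unfolding z_def by simp
qed

end

section \<open>Decomposition of a tree along a diametral path\<close>

lemma relpow_path:
  assumes "\<And>j. j < d \<Longrightarrow> (p j, p (Suc j)) \<in> E" and "i \<le> j" "j \<le> d"
  shows "(p i, p j) \<in> E ^^ (j - i)"
  unfolding relpow_fun_conv using assms by (intro exI[of _ "\<lambda>k. p (i + k)"]) auto

text \<open>A shortest walk between two vertices at maximal distance works: a repeated vertex would
  allow a shortcut.\<close>

lemma diametral_path:
  assumes T: "undirected_tree T" and d: "graph_diameter T = d"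
  obtains p where "\<And>j. j \<le> d \<Longrightarrow> p j \<in> verts T"
    and "\<And>j. j < d \<Longrightarrow> (p j, p (Suc j)) \<in> arcs_ends T" and "inj_on p {..d}"
proof -
  interpret graph T using T by (simp add: undirected_tree_def)
  let ?E = "arcs_ends T" and ?S = "{graph_dist T u v | u v. u \<in> verts T \<and> v \<in> verts T}"
  have "?S = (\<lambda>(u, v). graph_dist T u v) ` (verts T \<times> verts T)" by auto
  then have "finite ?S" by simp
  moreover have "verts T \<noteq> {}" using T by (auto simp: undirected_tree_def connected_conv)
  then have "?S \<noteq> {}" by auto
  ultimately have "graph_diameter T \<in> ?S" unfolding graph_diameter_def by (rule Max_in)
  then have "d \<in> ?S" by (simp only: d)
  then obtain u v where uv: "u \<in> verts T" "v \<in> verts T" "graph_dist T u v = d"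
    by blast
  then have dist: "reldist ?E u v = d" by (simp only: undirected_tree_dist[OF T uv(1,2)])
  have "(u, v) \<in> ?E ^^ d"
    using relpow_reldist[OF undirected_tree_connected[OF T uv(1,2)]] by (simp only: dist)
  then obtain p where p: "p 0 = u" "p d = v" "\<And>j. j < d \<Longrightarrow> (p j, p (Suc j)) \<in> ?E"
    unfolding relpow_fun_conv by auto
  have V: "p j \<in> verts T" if "j \<le> d" for j
  proof (cases "j = d")
    case False
    then show ?thesis using that p(3)[of j] by (auto dest: adj_in_verts)
  qed (use p uv in simp)
  have "p i \<noteq> p j" if "i < j" "j \<le> d" for i j
  proof
    assume eq: "p i = p j"
    have "(p 0, p i) \<in> ?E ^^ (i - 0)" using that p(3) by (intro relpow_path[where d = d]) auto
    moreover have "(p j, p d) \<in> ?E ^^ (d - j)" using that p(3) by (intro relpow_path[where d = d]) auto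
    ultimately have "(u, v) \<in> ?E ^^ (i + (d - j))" using p eq by (auto simp: relpow_add)
    then have "d \<le> i + (d - j)" using reldist_le dist by metis
    then show False using that by simp
  qed
  then have "inj_on p {..d}"
    by (intro linorder_inj_onI) (auto simp: order_antisym)
  with V p(3) that show thesis by blast
qed

text \<open>A parent is a chosen neighbour one step closer to the path, and the index is read off
  the path vertex reached by iterating \<open>par\<close>. Acyclicity of an arbitrary tree enters
  the argument only here, to exclude further edges.\<close>

lemma tree_spine:
  assumes T: "undirected_tree T"
    and V: "\<And>j. j \<le> d \<Longrightarrow> p j \<in> verts T"
    and E: "\<And>j. j < d \<Longrightarrow> (p j, p (Suc j)) \<in> arcs_ends T"
    and inj: "inj_on p {..d}"
  obtains idx ht par where "spine (verts T) (arcs_ends T) d p idx ht par"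
proof -
  interpret graph T using T by (simp add: undirected_tree_def)
  let ?E = "arcs_ends T"
  have E_V: "?E \<subseteq> verts T \<times> verts T" by (auto simp: arcs_ends_conv)
  have sym: "sym ?E" using sym_arcs by (simp add: symmetric_def)
  define ht where "ht v = (LEAST l. \<exists>j\<le>d. (v, p j) \<in> ?E ^^ l)" for v
  have ht_ex: "\<exists>j\<le>d. (v, p j) \<in> ?E ^^ ht v" if "v \<in> verts T" for v
  proof -
    have "(v, p 0) \<in> ?E\<^sup>*" using undirected_tree_connected[OF T that V] by simp
    then have "\<exists>l. \<exists>j\<le>d. (v, p j) \<in> ?E ^^ l" by (auto simp: rtrancl_power)
    then show ?thesis unfolding ht_def by (rule LeastI_ex)
  qed
  have ht_le: "ht v \<le> l" if "(v, p j) \<in> ?E ^^ l" "j \<le> d" for v j l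
    unfolding ht_def using that by (auto intro: Least_le)
  have ht_0: "ht v = 0 \<longleftrightarrow> v \<in> p ` {..d}" if v: "v \<in> verts T" for v
    using ht_ex[OF v] ht_le[of v _ 0] by auto
  have "\<exists>u. (v, u) \<in> ?E \<and> Suc (ht u) = ht v" if v: "v \<in> verts T" "0 < ht v" for v
  proof -
    obtain k where k: "ht v = Suc k" using v by (cases "ht v") auto
    then obtain j u where u: "j \<le> d" "(v, u) \<in> ?E" "(u, p j) \<in> ?E ^^ k"
      using ht_ex[OF v(1)] by (metis relpow_Suc_D2)
    then have "u \<in> verts T" using E_V by auto
    then obtain i where "i \<le> d" "(u, p i) \<in> ?E ^^ ht u" using ht_ex by blast
    then have "ht v \<le> Suc (ht u)" using u relpow_Suc_I2 ht_le by metis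
    moreover have "ht u \<le> k" using u ht_le by auto
    ultimately show ?thesis using u k by auto
  qed
  then obtain par where par: "\<And>v. v \<in> verts T \<Longrightarrow> 0 < ht v \<Longrightarrow> (v, par v) \<in> ?E \<and> Suc (ht (par v)) = ht v"
    by metis
  have par_V: "par v \<in> verts T" if "v \<in> verts T" "0 < ht v" for v
    using par[OF that] E_V by auto
  define idx where "idx v = the_inv_into {..d} p ((par ^^ ht v) v)" for v
  have root: "(par ^^ ht v) v \<in> p ` {..d}" if "v \<in> verts T" for v
    using that
  proof (induction "ht v" arbitrary: v)
    case 0
    then show ?case using ht_0[of v] by auto
  next
    case (Suc k)
    then have "ht (par v) = k" "par v \<in> verts T" using par[of v] par_V[of v] by auto
    moreover have "(par ^^ ht v) v = (par ^^ k) (par v)"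
      using Suc.hyps(2)[symmetric] by (simp add: funpow_swap1)
    ultimately show ?case using Suc.hyps(1)[of "par v"] by simp
  qed
  \<comment> \<open>The path edges and parent edges, in both directions. They connect every vertex
    to \<open>p 0\<close>, so by \<open>tree_edge_in_spanning_set\<close> they are all the
    edges.\<close>
  define H where "H = (\<Union>j<d. {(p j, p (Suc j)), (p (Suc j), p j)})
      \<union> (\<Union>v\<in>{v \<in> verts T. 0 < ht v}. {(v, par v), (par v, v)})"
  have H_E: "H \<subseteq> ?E"
    using E par sym by (auto simp: H_def dest: symD)
  have sym_H: "sym H" by (auto simp: H_def intro!: symI)
  have to_p0: "(v, p 0) \<in> H\<^sup>*" if "v \<in> verts T" for v
    using that
  proof (induction "ht v" arbitrary: v)
    case 0
    have "(p j, p 0) \<in> H\<^sup>*" if "j \<le> d" for j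
      using that
    proof (induction j)
      case (Suc j)
      then have "(p (Suc j), p j) \<in> H" by (auto simp: H_def)
      with Suc show ?case by auto
    qed simp
    with 0 ht_0[of v] show ?case by auto
  next
    case (Suc k)
    then have "(par v, p 0) \<in> H\<^sup>*" using par[of v] par_V[of v] by auto
    moreover have "(v, par v) \<in> H" using Suc unfolding H_def by auto
    ultimately show ?case by auto
  qed
  have E_H: "(a, b) \<in> H" if "(a, b) \<in> ?E" for a b
  proof -
    have "(b, p 0) \<in> H\<^sup>*" "(a, p 0) \<in> H\<^sup>*" using that E_V to_p0 by auto
    then have "(b, a) \<in> H\<^sup>*" using sym_rtrancl[OF sym_H] by (meson symD rtrancl_trans)
    then show ?thesis using tree_edge_in_spanning_set[OF T H_E that] sym_H by (auto dest: symD)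
  qed
  have "spine (verts T) ?E d p idx ht par"
  proof
    fix j assume j: "j \<le> d"
    then have "ht (p j) = 0" using ht_0 V by auto
    then show "idx (p j) = j" using j inj by (simp add: idx_def the_inv_into_f_f)
  next
    fix v assume v: "v \<in> verts T"
    then show "idx v \<le> d"
      using the_inv_into_into[OF inj root[OF v] order_refl] by (simp add: idx_def)
  next
    fix v assume v: "v \<in> verts T" "0 < ht v"
    then have "ht v = Suc (ht (par v))" using par by simp
    then show "idx (par v) = idx v" by (simp add: idx_def funpow_swap1)
  next
    fix u v assume "(u, v) \<in> ?E"
    then have "(u, v) \<in> H" by (rule E_H)
    then show "(\<exists>j<d. (u, v) = (p j, p (Suc j)) \<or> (v, u) = (p j, p (Suc j)))
          \<or> 0 < ht u \<and> v = par u \<or> 0 < ht v \<and> u = par v"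
      unfolding H_def by blast
  qed (use par par_V ht_0 V E sym E_V in auto)
  then show thesis by (rule that)
qed

section \<open>Perron vectors of the extremal trees\<close>

text \<open>Only the pairs with exactly one member in \<open>A\<close> are kept. Each contributes at
  least the overshoot beyond \<open>c\<close> and occurs in both orders, whence the factor
  2.\<close>

lemma sum_abs_diff_ge:
  fixes t :: "'a \<Rightarrow> nat" and c :: nat
  assumes fin: "finite W"
  defines "A \<equiv> {w \<in> W. t w \<le> c}"
  shows "2 * real (card A) * (\<Sum>w\<in>W - A. real (t w - c)) \<le> (\<Sum>u\<in>W. \<Sum>w\<in>W. \<bar>real (t u) - real (t w)\<bar>)"
proof -
  let ?B = "W - A" and ?g = "\<lambda>u w. \<bar>real (t u) - real (t w)\<bar>"
  have A: "A \<subseteq> W" "finite A" "finite ?B" "A \<inter> ?B = {}" using fin by (auto simp: A_def)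
  have W: "W = A \<union> ?B" using A by auto
  have split: "sum f W = sum f A + sum f ?B" for f :: "'a \<Rightarrow> real"
    using A by (metis W sum.union_disjoint)
  have cross: "real (card A) * (\<Sum>w\<in>?B. real (t w - c)) \<le> (\<Sum>w\<in>?B. \<Sum>u\<in>A. ?g w u)"
  proof -
    have "real (card A) * (\<Sum>w\<in>?B. real (t w - c)) = (\<Sum>w\<in>?B. \<Sum>u\<in>A. real (t w - c))"
      by (simp add: sum_distrib_left)
    also have "\<dots> \<le> (\<Sum>w\<in>?B. \<Sum>u\<in>A. ?g w u)"
      by (intro sum_mono) (auto simp: A_def)
    finally show ?thesis .
  qed
  have "(\<Sum>w\<in>?B. \<Sum>u\<in>A. ?g w u) = (\<Sum>u\<in>A. \<Sum>w\<in>?B. ?g u w)"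
    by (subst sum.swap) (simp add: abs_minus_commute)
  moreover have "(\<Sum>u\<in>A. \<Sum>w\<in>A. ?g u w) \<ge> 0" "(\<Sum>u\<in>?B. \<Sum>w\<in>?B. ?g u w) \<ge> 0"
    by (auto intro!: sum_nonneg)
  moreover have "(\<Sum>u\<in>W. \<Sum>w\<in>W. ?g u w) = (\<Sum>u\<in>A. \<Sum>w\<in>A. ?g u w) + (\<Sum>u\<in>A. \<Sum>w\<in>?B. ?g u w)
      + ((\<Sum>w\<in>?B. \<Sum>u\<in>A. ?g w u) + (\<Sum>u\<in>?B. \<Sum>w\<in>?B. ?g u w))"
    by (simp add: split sum.distrib)
  ultimately show ?thesis using cross by simp
qed

text \<open>The next lemma is a discrete maximum principle for \<open>\<delta>'' = (2 / l) \<delta>\<close> with free boundary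
  at \<open>0\<close>.\<close>

lemma recurrence_mono:
  fixes \<delta> :: "nat \<Rightarrow> real"
  assumes l: "0 < l" and rec: "\<And>q. q < c \<Longrightarrow> l * (\<delta> (Suc q) - \<delta> q) = 2 * (\<Sum>j\<le>q. \<delta> j)"
    and 0: "0 \<le> \<delta> 0" and q: "q \<le> c"
  shows "\<forall>j\<le>q. 0 \<le> \<delta> j \<and> \<delta> j \<le> \<delta> q"
  using q
proof (induction q)
  case (Suc q)
  then have IH: "\<forall>j\<le>q. 0 \<le> \<delta> j \<and> \<delta> j \<le> \<delta> q" by simp
  then have "0 \<le> l * (\<delta> (Suc q) - \<delta> q)" using rec[of q] Suc by (auto intro!: sum_nonneg)
  then have "\<delta> q \<le> \<delta> (Suc q)" using l by (simp add: zero_le_mult_iff)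
  with IH show ?case by (auto simp: le_Suc_eq intro: order_trans)
qed (use 0 in simp)

text \<open>Here \<open>\<xi>\<close> and \<open>y\<close> are the entries of a positive eigenvector, for the eigenvalue \<open>l\<close>, of the
  distance matrix of the path \<open>0, \<dots>, d\<close> with \<open>m\<close> pendant vertices attached at its centre \<open>c\<close>.\<close>

locale perron =
  fixes d m c :: nat and \<xi> :: "nat \<Rightarrow> real" and y l :: real
  assumes c_def: "c = d div 2" and d: "2 \<le> d" and m: "0 < m"
    and \<xi>_pos: "j \<le> d \<Longrightarrow> 0 < \<xi> j" and y_pos: "0 < y"
    and ev_path: "i \<le> d \<Longrightarrow> (\<Sum>j\<le>d. \<bar>real i - real j\<bar> * \<xi> j) + real m * y * (1 + \<bar>real i - real c\<bar>) = l * \<xi> i"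
    and ev_pendant: "(\<Sum>j\<le>d. (1 + \<bar>real c - real j\<bar>) * \<xi> j) + 2 * (real m - 1) * y = l * y"
begin

text \<open>The weights of the two halves of the path; for even \<open>d\<close> the centre is
  counted on the left. \<open>f i\<close> is the weighted distance from \<open>i\<close> to the
  path.\<close>

definition "Lsum = (\<Sum>j\<le>c. \<xi> j)"
definition "Rsum = (\<Sum>j\<in>{c<..d}. \<xi> j)"
definition "f i = (\<Sum>j\<le>d. \<bar>real i - real j\<bar> * \<xi> j)"

lemma cd: "c < d" "Suc c \<le> d"
  using d by (auto simp: c_def)

lemma sum_split_at:
  fixes g :: "nat \<Rightarrow> real"
  assumes "q \<le> d"
  shows "(\<Sum>j\<le>d. g j) = (\<Sum>j\<le>q. g j) + (\<Sum>j\<in>{q<..d}. g j)"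
proof -
  have "{..d} = {..q} \<union> {q<..d}" using assms by auto
  then show ?thesis by (simp add: sum.union_disjoint ivl_disj_int)
qed

text \<open>Add the eigenvalue equations at both ends of the path: every path vertex has distances
  to the ends adding up to \<open>d\<close>, and the pendant terms are nonnegative.\<close>

lemma l_ge: "real d \<le> l"
proof -
  have "real d * (\<xi> 0 + \<xi> d) \<le> real d * (\<Sum>j\<le>d. \<xi> j)"
  proof (intro mult_left_mono)
    have "(\<Sum>j\<in>{0, d}. \<xi> j) \<le> (\<Sum>j\<le>d. \<xi> j)"
      using \<xi>_pos by (intro sum_mono2) (auto intro: less_imp_le)
    then show "\<xi> 0 + \<xi> d \<le> (\<Sum>j\<le>d. \<xi> j)" using d by simp
  qed simp
  also have "\<dots> = f 0 + f d"
    by (auto simp: f_def sum_distrib_left simp flip: sum.distrib ring_distribs intro!: sum.cong)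
  also have "\<dots> \<le> l * (\<xi> 0 + \<xi> d)"
  proof -
    have "0 \<le> real m * y * (1 + \<bar>real i - real c\<bar>)" for i :: nat using y_pos by simp
    from this[of 0] this[of d] show ?thesis
      using ev_path[of 0] ev_path[of d] by (simp add: f_def ring_distribs)
  qed
  finally show ?thesis using \<xi>_pos[of 0] \<xi>_pos[of d] by (simp add: mult_le_cancel_right)
qed

lemma l_pos: "0 < l"
  using l_ge d by simp

text \<open>A step to the right brings all later vertices closer by one and takes all others farther
  away by one.\<close>

lemma f_step:
  assumes "q < d"
  shows "f q - f (Suc q) = (\<Sum>j\<in>{q<..d}. \<xi> j) - (\<Sum>j\<le>q. \<xi> j)"
proof -
  have "f q - f (Suc q) = (\<Sum>j\<le>d. (\<bar>real q - real j\<bar> - \<bar>real (Suc q) - real j\<bar>) * \<xi> j)"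
    by (simp add: f_def sum_subtractf left_diff_distrib)
  also have "\<dots> = (\<Sum>j\<le>q. - \<xi> j) + (\<Sum>j\<in>{q<..d}. \<xi> j)"
    using assms by (subst sum_split_at[of q]) (auto intro!: arg_cong2[of _ _ _ _ "(+)"] sum.cong)
  finally show ?thesis by (simp add: sum_negf)
qed

lemma ev_step:
  assumes "q < d"
  shows "l * (\<xi> q - \<xi> (Suc q)) = (\<Sum>j\<in>{q<..d}. \<xi> j) - (\<Sum>j\<le>q. \<xi> j)
     + (if q < c then real m * y else - real m * y)"
proof -
  have "l * (\<xi> q - \<xi> (Suc q)) = f q - f (Suc q)
      + real m * y * (\<bar>real q - real c\<bar> - \<bar>real (Suc q) - real c\<bar>)"
    using ev_path[of q] ev_path[of "Suc q"] assms by (simp add: f_def algebra_simps)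
  moreover have "\<bar>real q - real c\<bar> - \<bar>real (Suc q) - real c\<bar> = (if q < c then 1 else - 1)"
    by auto
  ultimately show ?thesis by (simp add: f_step[OF assms])
qed

text \<open>The failure of mirror symmetry of the Perron entries.\<close>

definition "\<delta> q = \<xi> (d - q) - \<xi> q"

lemma sum_upper:
  assumes "q < d"
  shows "(\<Sum>j\<in>{d - Suc q<..d}. \<xi> j) = (\<Sum>j\<le>q. \<xi> (d - j))"
  by (rule sum.reindex_bij_witness[of _ "\<lambda>j. d - j" "\<lambda>j. d - j"]) (use assms in auto)

text \<open>Add \<open>ev_step\<close> at \<open>q\<close> and at its mirror step
  \<open>d - Suc q\<close>: these lie on opposite sides of the pendant vertices, so the terms
  \<open>real m * y\<close> cancel.\<close>

lemma \<delta>_rec: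
  assumes q: "q < c"
  shows "l * (\<delta> (Suc q) - \<delta> q) = 2 * (\<Sum>j\<le>q. \<delta> j)"
proof -
  define r where "r = d - Suc q"
  have r: "r < d" "\<not> r < c" "Suc r = d - q" "q < d" using q d by (auto simp: r_def c_def)
  have "l * (\<delta> (Suc q) - \<delta> q) = l * (\<xi> r - \<xi> (Suc r)) + l * (\<xi> q - \<xi> (Suc q))"
    using r by (simp add: \<delta>_def r_def algebra_simps)
  also have "\<dots> = (\<Sum>j\<in>{r<..d}. \<xi> j) - (\<Sum>j\<le>r. \<xi> j) + ((\<Sum>j\<in>{q<..d}. \<xi> j) - (\<Sum>j\<le>q. \<xi> j))"
    using ev_step[of r] ev_step[of q] r q by simp
  also have "\<dots> = 2 * ((\<Sum>j\<in>{r<..d}. \<xi> j) - (\<Sum>j\<le>q. \<xi> j))"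
    using sum_split_at[of r \<xi>] sum_split_at[of q \<xi>] r by simp
  also have "(\<Sum>j\<in>{r<..d}. \<xi> j) = (\<Sum>j\<le>q. \<xi> (d - j))" unfolding r_def using r by (intro sum_upper) auto
  finally show ?thesis by (simp add: \<delta>_def sum_subtractf)
qed

text \<open>The recurrence is linear, so \<open>recurrence_mono\<close> applies to \<delta> or to
  its negative: the sign is constant and the absolute value is largest at the centre.\<close>

lemma \<delta>_cases:
  "(\<forall>j\<le>c. 0 \<le> \<delta> j \<and> \<delta> j \<le> \<delta> c) \<or> \<delta> 0 < 0 \<and> (\<forall>j\<le>c. \<delta> j \<le> 0 \<and> \<delta> c \<le> \<delta> j)"
proof (cases "0 \<le> \<delta> 0")
  case True
  then show ?thesis using recurrence_mono[OF l_pos \<delta>_rec, of c] by blast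
next
  case False
  have "l * (- \<delta> (Suc q) - - \<delta> q) = 2 * (\<Sum>j\<le>q. - \<delta> j)" if "q < c" for q
    using \<delta>_rec[OF that] by (simp add: sum_negf algebra_simps)
  from recurrence_mono[OF l_pos this, of c c] False show ?thesis by force
qed

text \<open>For even \<open>d\<close>, \<delta> vanishes at \<open>c\<close>, which is its own
  mirror image, hence everywhere, and the halves differ by \<open>\<xi> c\<close> only. For odd
  \<open>d\<close>, \<open>Rsum - Lsum\<close> is the sum of \<delta>, at most
  \<open>Suc c * \<delta> c\<close>, while \<open>ev_step\<close> across the central edge gives
  \<open>l * \<delta> c = real m * y - (Rsum - Lsum)\<close>; now \<open>Suc c < d \<le> l\<close>
  yields the second bound.\<close>

lemma Rsum_Lsum:
  "Lsum - Rsum < 2 * \<xi> c" "2 * (Rsum - Lsum) < real m * y"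
proof -
  have my: "0 < real m * y" using m y_pos by simp
  have "Lsum - Rsum < 2 * \<xi> c \<and> 2 * (Rsum - Lsum) < real m * y"
  proof (cases "even d")
    case True
    then have dc: "d - c = c" "0 < c" using d by (auto simp: c_def)
    then have "\<delta> c = 0" by (simp add: \<delta>_def)
    then have \<delta>0: "\<delta> j = 0" if "j \<le> c" for j using \<delta>_cases that by force
    have "d - Suc (c - 1) = c" using dc by simp
    then have "Rsum = (\<Sum>j\<le>c - 1. \<xi> (d - j))"
      using sum_upper[of "c - 1"] dc cd by (simp add: Rsum_def)
    also have "\<dots> = (\<Sum>j\<le>c - 1. \<xi> j)"
      using \<delta>0 dc by (intro sum.cong) (auto simp: \<delta>_def)
    finally have "Lsum = Rsum + \<xi> c"
      unfolding Lsum_def using dc by (cases c) auto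
    then show ?thesis using \<xi>_pos[of c] cd my by simp
  next
    case False
    then have dc: "d - Suc c = c" "Suc c = d - c" using d by (auto simp: c_def elim!: oddE)
    have "Rsum = (\<Sum>j\<le>c. \<xi> (d - j))" using sum_upper[of c] dc cd by (simp add: Rsum_def)
    then have diff: "Rsum - Lsum = (\<Sum>j\<le>c. \<delta> j)" by (simp add: Lsum_def \<delta>_def sum_subtractf)
    have "l * (\<xi> c - \<xi> (Suc c)) = Rsum - Lsum - real m * y"
      using ev_step[of c] cd by (simp add: Rsum_def Lsum_def)
    then have lc: "l * \<delta> c = real m * y - (Rsum - Lsum)"
      using dc by (simp add: \<delta>_def algebra_simps)
    have nonneg: "\<forall>j\<le>c. 0 \<le> \<delta> j \<and> \<delta> j \<le> \<delta> c"
    proof (rule ccontr)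
      assume "\<not> ?thesis"
      then have neg: "\<forall>j\<le>c. \<delta> j \<le> 0" using \<delta>_cases by auto
      then have "Rsum - Lsum \<le> 0" unfolding diff by (auto intro!: sum_nonpos)
      moreover have "l * \<delta> c \<le> 0" using neg l_pos by (simp add: mult_le_0_iff)
      ultimately show False using lc my by simp
    qed
    have ge: "0 \<le> Rsum - Lsum" unfolding diff using nonneg by (auto intro!: sum_nonneg)
    have "Rsum - Lsum \<le> (\<Sum>j\<le>c. \<delta> c)" unfolding diff using nonneg by (intro sum_mono) auto
    then have le: "Rsum - Lsum \<le> real (Suc c) * \<delta> c" by simp
    have "2 * (Rsum - Lsum) < real m * y"
    proof (cases "\<delta> c = 0")
      case True
      then show ?thesis using le my by simp
    next
      case False
      then have "0 < \<delta> c" using nonneg by (simp add: less_le)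
      moreover have "real (Suc c) < l" using l_ge d \<open>odd d\<close> by (auto simp: c_def elim!: oddE)
      ultimately have "real (Suc c) * \<delta> c < l * \<delta> c" by simp
      then show ?thesis using le lc by simp
    qed
    then show ?thesis using ge \<xi>_pos[of c] cd by simp
  qed
  then show "Lsum - Rsum < 2 * \<xi> c" "2 * (Rsum - Lsum) < real m * y" by auto
qed

text \<open>Compare a pendant vertex with \<open>Suc c\<close>, the other kind of neighbour of
  \<open>c\<close>: their equations differ by
  \<open>l * (y - \<xi> (Suc c)) = 2 * (Rsum - y)\<close>. A value \<open>y\<close> of at least the
  whole path weight would thus be smaller than the single entry
  \<open>\<xi> (Suc c)\<close>.\<close>

lemma y_less: "y < (\<Sum>j\<le>d. \<xi> j)"
proof (rule ccontr)
  assume "\<not> ?thesis"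
  then have y: "Lsum + Rsum \<le> y" using sum_split_at[of c \<xi>] cd by (simp add: Lsum_def Rsum_def)
  have L: "0 < Lsum" unfolding Lsum_def using \<xi>_pos cd by (intro sum_pos) auto
  have "(\<Sum>j\<le>d. (1 + \<bar>real c - real j\<bar>) * \<xi> j) - f (Suc c)
      = (\<Sum>j\<le>d. (1 + \<bar>real c - real j\<bar> - \<bar>real (Suc c) - real j\<bar>) * \<xi> j)"
    by (simp add: f_def sum_subtractf left_diff_distrib)
  also have "\<dots> = (\<Sum>j\<le>c. 0) + (\<Sum>j\<in>{c<..d}. 2 * \<xi> j)"
    using cd by (subst sum_split_at[of c]) (auto intro!: arg_cong2[of _ _ _ _ "(+)"] sum.cong sum.neutral)
  finally have "(\<Sum>j\<le>d. (1 + \<bar>real c - real j\<bar>) * \<xi> j) = f (Suc c) + 2 * Rsum"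
    by (simp add: Rsum_def sum_distrib_left)
  then have "l * (y - \<xi> (Suc c)) = 2 * (Rsum - y)"
    using ev_path[of "Suc c"] ev_pendant cd by (simp add: f_def algebra_simps)
  moreover have "Rsum - y < 0" using y L by simp
  ultimately have "l * (y - \<xi> (Suc c)) < 0" by simp
  then have "y < \<xi> (Suc c)" using l_pos by (simp add: mult_less_0_iff)
  moreover have "\<xi> (Suc c) \<le> Rsum"
    unfolding Rsum_def using \<xi>_pos cd by (intro member_le_sum) (auto intro: less_imp_le)
  ultimately show False using y L by simp
qed

text \<open>Moving from \<open>c\<close> left to \<open>i\<close>, the vertices from
  \<open>c\<close> onwards recede by the full \<open>c - i\<close> and the others approach by at
  most that. The centre recedes although \<open>Lsum\<close> contains it, hence the correction
  \<open>2 * \<xi> c\<close>.\<close>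

lemma f_left:
  assumes "i \<le> c"
  shows "real (c - i) * (Rsum - Lsum + 2 * \<xi> c) \<le> f i - f c"
proof -
  let ?s = "\<lambda>j. if c \<le> j then 1 else - 1 :: real"
  have "real (c - i) * (Rsum - Lsum + 2 * \<xi> c) = real (c - i) * (\<Sum>j\<le>d. ?s j * \<xi> j)"
  proof -
    have "(\<Sum>j\<le>c. ?s j * \<xi> j) = (\<Sum>j\<le>c. - \<xi> j + (if j = c then 2 * \<xi> c else 0))"
      by (intro sum.cong) auto
    then have "(\<Sum>j\<le>c. ?s j * \<xi> j) = - Lsum + 2 * \<xi> c" by (simp add: sum.distrib sum_negf sum_subtractf Lsum_def)
    moreover have "(\<Sum>j\<in>{c<..d}. ?s j * \<xi> j) = Rsum" unfolding Rsum_def by (intro sum.cong) auto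
    ultimately show ?thesis using cd by (subst sum_split_at[of c]) auto
  qed
  also have "\<dots> = (\<Sum>j\<le>d. real (c - i) * ?s j * \<xi> j)" by (simp add: sum_distrib_left mult.assoc)
  also have "\<dots> \<le> (\<Sum>j\<le>d. (\<bar>real i - real j\<bar> - \<bar>real c - real j\<bar>) * \<xi> j)"
    using assms \<xi>_pos by (intro sum_mono mult_right_mono) (auto simp: less_imp_le)
  also have "\<dots> = f i - f c" by (simp add: f_def sum_subtractf left_diff_distrib)
  finally show ?thesis .
qed

text \<open>The mirror estimate; here the centre is on the receding side together with the rest of
  \<open>Lsum\<close>, so no correction arises.\<close>

lemma f_right:
  assumes "c \<le> i"
  shows "real (i - c) * (Lsum - Rsum) \<le> f i - f c"
proof -
  let ?s = "\<lambda>j. if j \<le> c then 1 else - 1 :: real"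
  have "real (i - c) * (Lsum - Rsum) = real (i - c) * (\<Sum>j\<le>d. ?s j * \<xi> j)"
  proof -
    have "(\<Sum>j\<le>c. ?s j * \<xi> j) = Lsum" unfolding Lsum_def by (intro sum.cong) auto
    moreover have "(\<Sum>j\<in>{c<..d}. ?s j * \<xi> j) = - Rsum"
      unfolding Rsum_def sum_negf[symmetric] by (intro sum.cong) auto
    ultimately show ?thesis using cd by (subst sum_split_at[of c]) auto
  qed
  also have "\<dots> = (\<Sum>j\<le>d. real (i - c) * ?s j * \<xi> j)" by (simp add: sum_distrib_left mult.assoc)
  also have "\<dots> \<le> (\<Sum>j\<le>d. (\<bar>real i - real j\<bar> - \<bar>real c - real j\<bar>) * \<xi> j)"
    using assms \<xi>_pos by (intro sum_mono mult_right_mono) (auto simp: less_imp_le)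
  also have "\<dots> = f i - f c" by (simp add: f_def sum_subtractf left_diff_distrib)
  finally show ?thesis .
qed

text \<open>Here \<open>h w\<close> and \<open>t w\<close> are the height and the index of a vertex \<open>w\<close> off the path.\<close>

lemma gain:
  fixes h t :: "'a \<Rightarrow> nat"
  assumes fin: "finite W" and card: "card W = m" and h: "\<And>w. w \<in> W \<Longrightarrow> 1 \<le> h w"
    and half: "m \<le> 2 * card {w \<in> W. t w \<le> c}"
  defines "G \<equiv> 2 * y * (\<Sum>w\<in>W. (real (h w) - 1) * ((\<Sum>j\<le>d. \<xi> j) - y) + (f (t w) - f c))
       + y\<^sup>2 * (\<Sum>u\<in>W. \<Sum>w\<in>W. \<bar>real (t u) - real (t w)\<bar>)"
  shows "0 \<le> G" and "G \<le> 0 \<Longrightarrow> w \<in> W \<Longrightarrow> h w = 1 \<and> t w = c"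
proof -
  define A where "A = {w \<in> W. t w \<le> c}"
  \<comment> \<open>\<alpha> and \<beta> are guaranteed gains per step away from the centre, to the
    left and to the right. The first part of \<beta> may be negative; its second part is the
    increased distance to the vertices of \<open>A\<close>, and \<open>half\<close> makes the sum
    positive.\<close>
  define \<alpha> where "\<alpha> = Rsum - Lsum + 2 * \<xi> c"
  define \<beta> where "\<beta> = Lsum - Rsum + y * real (card A)"
  define X where "X = (\<Sum>j\<le>d. \<xi> j)"
  have \<alpha>: "0 < \<alpha>" using Rsum_Lsum by (simp add: \<alpha>_def)
  have "real m * y \<le> 2 * (y * real (card A))"
  proof -
    have "real m \<le> 2 * real (card A)" using half by (simp add: A_def)
    then show ?thesis using y_pos mult_right_mono[of "real m" "2 * real (card A)" y] by (simp add: ac_simps)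
  qed
  then have \<beta>: "0 < \<beta>" using Rsum_Lsum by (simp add: \<beta>_def)
  \<comment> \<open>The net gain per unit of height: the path weight gained, less the
    \<open>y\<close> paid for a possible edge to the parent.\<close>
  have X: "0 < X - y" using y_less by (simp add: X_def)
  define g where "g w = (real (h w) - 1) * (X - y) + (if w \<in> A then real (c - t w) * \<alpha> else real (t w - c) * \<beta>)" for w
  have g0: "0 \<le> g w" if "w \<in> W" for w
    using that h[OF that] \<alpha> \<beta> X by (auto simp: g_def)
  have A: "A \<subseteq> W" "finite A" using fin by (auto simp: A_def)
  have split: "sum F W = sum F A + sum F (W - A)" for F :: "'a \<Rightarrow> real"
    using A fin by (metis add.commute sum.subset_diff)
  have "2 * y * (\<Sum>w\<in>W. g w) \<le> G"
  proof -
    have l: "(\<Sum>w\<in>A. real (c - t w) * \<alpha>) \<le> (\<Sum>w\<in>A. f (t w) - f c)"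
      unfolding \<alpha>_def by (intro sum_mono f_left) (auto simp: A_def)
    have r: "(\<Sum>w\<in>W - A. real (t w - c) * (Lsum - Rsum)) \<le> (\<Sum>w\<in>W - A. f (t w) - f c)"
      by (intro sum_mono f_right) (auto simp: A_def)
    have ab: "y\<^sup>2 * (2 * real (card A) * (\<Sum>w\<in>W - A. real (t w - c)))
        \<le> y\<^sup>2 * (\<Sum>u\<in>W. \<Sum>w\<in>W. \<bar>real (t u) - real (t w)\<bar>)"
      using sum_abs_diff_ge[OF fin, of t c] unfolding A_def by (intro mult_left_mono) auto
    have "(\<Sum>w\<in>W. g w) = (\<Sum>w\<in>W. (real (h w) - 1) * (X - y)) + (\<Sum>w\<in>A. real (c - t w) * \<alpha>)
        + (\<Sum>w\<in>W - A. real (t w - c) * \<beta>)"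
    proof -
      have "(\<Sum>w\<in>W. if w \<in> A then real (c - t w) * \<alpha> else real (t w - c) * \<beta>)
          = (\<Sum>w\<in>A. real (c - t w) * \<alpha>) + (\<Sum>w\<in>W - A. real (t w - c) * \<beta>)"
        by (subst split) (auto intro!: arg_cong2[of _ _ _ _ "(+)"] sum.cong)
      then show ?thesis by (simp add: g_def sum.distrib)
    qed
    also have "(\<Sum>w\<in>W - A. real (t w - c) * \<beta>) = (\<Sum>w\<in>W - A. real (t w - c) * (Lsum - Rsum))
        + y * real (card A) * (\<Sum>w\<in>W - A. real (t w - c))"
      by (simp add: \<beta>_def ring_distribs sum.distrib sum_distrib_left ac_simps)
    finally have "(\<Sum>w\<in>W. g w) \<le> (\<Sum>w\<in>W. (real (h w) - 1) * (X - y)) + (\<Sum>w\<in>W. f (t w) - f c)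
        + y * real (card A) * (\<Sum>w\<in>W - A. real (t w - c))"
      using l r split[of "\<lambda>w. f (t w) - f c"] by linarith
    then have "2 * y * (\<Sum>w\<in>W. g w) \<le> 2 * y * ((\<Sum>w\<in>W. (real (h w) - 1) * (X - y)) + (\<Sum>w\<in>W. f (t w) - f c)
        + y * real (card A) * (\<Sum>w\<in>W - A. real (t w - c)))"
      using y_pos by (intro mult_left_mono) auto
    also have "\<dots> = 2 * y * (\<Sum>w\<in>W. (real (h w) - 1) * (X - y) + (f (t w) - f c))
        + y\<^sup>2 * (2 * real (card A) * (\<Sum>w\<in>W - A. real (t w - c)))"
      by (simp only: sum.distrib) (simp add: algebra_simps power2_eq_square)
    also have "\<dots> \<le> G" using ab by (simp add: G_def X_def)
    finally show ?thesis .
  qed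
  moreover have s0: "0 \<le> (\<Sum>w\<in>W. g w)" using g0 by (rule sum_nonneg)
  ultimately show "0 \<le> G" using y_pos by (meson mult_nonneg_nonneg order_trans less_imp_le zero_le_numeral)
  assume "G \<le> 0" and w: "w \<in> W"
  with \<open>2 * y * (\<Sum>w\<in>W. g w) \<le> G\<close> y_pos have "(\<Sum>w\<in>W. g w) \<le> 0"
    by (smt (verit) mult_pos_pos)
  then have "(\<Sum>w\<in>W. g w) = 0" using s0 by simp
  then have gw: "g w = 0" using sum_nonneg_eq_0_iff[OF fin, of g] g0 w by auto
  have a: "0 \<le> (real (h w) - 1) * (X - y)" using h[OF w] X by simp
  have b: "0 \<le> (if w \<in> A then real (c - t w) * \<alpha> else real (t w - c) * \<beta>)" using \<alpha> \<beta> by simp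
  \<comment> \<open>Both nonnegative parts of a vanishing summand vanish; as \<open>X - y\<close>,
    \<alpha> and \<beta> are positive, the height and the index are determined.\<close>
  have "(real (h w) - 1) * (X - y) = 0" "(if w \<in> A then real (c - t w) * \<alpha> else real (t w - c) * \<beta>) = 0"
    using a b gw unfolding g_def by linarith+
  then show "h w = 1 \<and> t w = c" using X \<alpha> \<beta> w by (auto simp: A_def split: if_splits)
qed

end

section \<open>The extremal trees\<close>

lemma undirected_tree_spectral_radius:
  assumes T: "undirected_tree T" and card: "2 \<le> card (verts T)"
  obtains x where "\<And>v. v \<in> verts T \<Longrightarrow> 0 < x v"
    and "\<And>u. u \<in> verts T \<Longrightarrow>
      (\<Sum>v\<in>verts T. real (reldist (arcs_ends T) u v) * x v) = dist_spectral_radius T * x u"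
    and "\<And>y. quad_form (verts T) (\<lambda>u v. real (reldist (arcs_ends T) u v)) y
      \<le> dist_spectral_radius T * (\<Sum>v\<in>verts T. (y v)\<^sup>2)"
proof -
  interpret graph T using T by (simp add: undirected_tree_def)
  let ?D = "\<lambda>u v. real (reldist (arcs_ends T) u v)" and ?V = "verts T"
  have sym: "reldist (arcs_ends T) u v = reldist (arcs_ends T) v u" for u v
    using sym_arcs by (intro reldist_commute) (simp add: symmetric_def)
  have pos: "0 < ?D u v" if uv: "u \<in> ?V" "v \<in> ?V" "u \<noteq> v" for u v
  proof -
    have "(u, v) \<in> arcs_ends T ^^ reldist (arcs_ends T) u v"
      using undirected_tree_connected[OF T uv(1,2)] by (rule relpow_reldist)
    then have "reldist (arcs_ends T) u v \<noteq> 0" using uv(3) by (intro notI) simp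
    then show ?thesis by simp
  qed
  obtain l x where x: "\<And>v. v \<in> ?V \<Longrightarrow> 0 < x v"
    and ev: "\<And>u. u \<in> ?V \<Longrightarrow> (\<Sum>v\<in>?V. ?D u v * x v) = l * x u"
    and max: "\<And>y. quad_form ?V ?D y \<le> l * (\<Sum>v\<in>?V. (y v)\<^sup>2)"
    by (rule positive_eigenvector[of ?V ?D]) (use card pos sym in auto)
  have dist: "graph_dist T u v = reldist (arcs_ends T) u v" if "u \<in> ?V" "v \<in> ?V" for u v
    using undirected_tree_dist[OF T that] .
  obtain a where a: "a \<in> ?V" using card by (metis card.empty ex_in_conv not_numeral_le_zero)
  have "dist_spectral_radius T = l"
  proof (rule dist_spectral_radius_eqI)
    show "quad_form ?V (\<lambda>u v. real (graph_dist T u v)) y \<le> l * (\<Sum>v\<in>?V. (y v)\<^sup>2)" for y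
      using max[of y] by (simp add: quad_form_def dist cong: sum.cong)
    show "(\<Sum>v\<in>?V. real (graph_dist T u v) * x v) = l * x u" if "u \<in> ?V" for u
      using ev[OF that] that by (simp add: dist cong: sum.cong)
    show "x a \<noteq> 0" using x[OF a] by simp
  qed (use a in auto)
  then show thesis using that[of x] x ev max by simp
qed

lemma dist_spectral_radius_iso:
  assumes G: "undirected_tree G" and H: "undirected_tree H" and iso: "digraph_iso G H"
  shows "dist_spectral_radius G = dist_spectral_radius H"
proof -
  interpret G: graph G using G by (simp add: undirected_tree_def)
  obtain h where h: "pre_digraph.digraph_isomorphism G h" "H = app_iso h G"
    using iso by (auto simp: digraph_iso_def)
  let ?f = "iso_verts h"
  have inj: "inj_on ?f (verts G)" using h(1) by (simp add: pre_digraph.digraph_isomorphism_def)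
  have V: "verts H = ?f ` verts G" by (simp add: h(2) verts_app_iso)
  have E: "arcs_ends H = map_prod ?f ?f ` arcs_ends G"
    using G.iso_verts_tail[OF h(1)] G.iso_verts_head[OF h(1)]
    by (auto simp: h(2) arcs_ends_conv app_iso_def image_image intro!: image_cong)
  have E_V: "arcs_ends G \<subseteq> verts G \<times> verts G" by (auto simp: arcs_ends_conv)
  obtain vs where vs: "distinct vs" "set vs = verts G"
    using finite_distinct_list[OF G.finite_verts] by blast
  have ws: "vertex_enum H (map ?f vs)" using vs V inj by (simp add: vertex_enum_def distinct_map)
  have "dist_matrix H (map ?f vs) = dist_matrix G vs"
  proof (rule eq_matI)
    fix i j assume "i < dim_row (dist_matrix G vs)" "j < dim_col (dist_matrix G vs)"
    then have ij: "i < length vs" "j < length vs" by (auto simp: dist_matrix_def)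
    then have v: "vs ! i \<in> verts G" "vs ! j \<in> verts G" unfolding vs(2)[symmetric] by auto
    have "graph_dist H (?f (vs ! i)) (?f (vs ! j)) = reldist (arcs_ends H) (?f (vs ! i)) (?f (vs ! j))"
      using v by (intro undirected_tree_dist[OF H]) (auto simp: V)
    also have "\<dots> = graph_dist G (vs ! i) (vs ! j)"
      unfolding E by (simp add: reldist_map[OF inj E_V v] undirected_tree_dist[OF G v])
    finally show "dist_matrix H (map ?f vs) $$ (i, j) = dist_matrix G vs $$ (i, j)"
      using ij by (simp add: dist_matrix_def)
  qed (simp_all add: dist_matrix_def)
  then show ?thesis
    using dist_spectral_radius_eq[OF ws] dist_spectral_radius_eq[of G vs] vs
    by (simp add: vertex_enum_def)
qed

text \<open>\<open>T1\<close> and \<open>T2\<close> are the cases of odd and even \<open>d\<close>,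
  since \<open>d div 2\<close> is \<open>k - 1\<close> for \<open>2 * k - 1\<close> and
  \<open>k\<close> for \<open>2 * k\<close>; one argument covers both parities.\<close>

definition centred_tree :: "nat \<Rightarrow> nat \<Rightarrow> (nat, nat \<times> nat) pre_digraph" where
  "centred_tree n d = with_proj (attach_pendants (path_graph (Suc d)) (d div 2) {Suc d..<n})"

lemma T1_eq_centred_tree: "1 \<le> k \<Longrightarrow> T1 n k = centred_tree n (2 * k - 1)"
proof -
  assume "1 \<le> k"
  then have "2 * k = Suc (2 * k - 1)" "k - 1 = (2 * k - 1) div 2" by auto
  then show ?thesis unfolding T1_def centred_tree_def by metis
qed

lemma T2_eq_centred_tree: "T2 n k = centred_tree n (2 * k)"
  by (simp add: T2_def centred_tree_def)

text \<open>From \<open>2 \<le> d\<close> the centre is an inner vertex of the path, so pendant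
  vertices there do not increase the diameter.\<close>

locale centred =
  fixes n d c :: nat
  assumes d: "2 \<le> d" and n: "d < n" and c_def: "c = d div 2"
begin

abbreviation "T \<equiv> centred_tree n d"
abbreviation "E \<equiv> arcs_ends T"

lemma c_le: "c < d"
  using d by (simp add: c_def)

lemma verts_T: "verts T = {..<n}"
  using n by (auto simp: centred_tree_def attach_pendants_def path_graph_def)

lemma arcs_T: "arcs T = {(i, j). i \<le> d \<and> j \<le> d \<and> (j = Suc i \<or> i = Suc j)}
    \<union> {c} \<times> {d<..<n} \<union> {d<..<n} \<times> {c}"
  by (auto simp: centred_tree_def attach_pendants_def path_graph_def c_def)

lemma E_eq: "E = arcs T"
  by (simp add: centred_tree_def)

lemma E_iff: "(u, v) \<in> E \<longleftrightarrow> u \<le> d \<and> v \<le> d \<and> (v = Suc u \<or> u = Suc v)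
    \<or> u = c \<and> v \<in> {d<..<n} \<or> v = c \<and> u \<in> {d<..<n}"
  by (auto simp: E_eq arcs_T)

lemma sym_E: "sym E"
  by (auto simp: E_iff intro!: symI)

lemma graph_T: "graph T"
proof
  fix e assume "e \<in> arcs T"
  then show "tail T e \<in> verts T" "head T e \<in> verts T" "tail T e \<noteq> head T e"
    using c_le n unfolding arcs_T verts_T by (auto simp: centred_tree_def)
next
  have "arcs T \<subseteq> {..<n} \<times> {..<n}" using c_le n by (auto simp: arcs_T)
  then show "finite (arcs T)" by (rule finite_subset) simp
  show "finite (verts T)" by (simp add: verts_T)
  show "symmetric T" using sym_E by (simp add: symmetric_def)
next
  fix a b assume "arc_to_ends T a = arc_to_ends T b"
  then show "a = b" by (simp add: centred_tree_def arc_to_ends_def prod_eq_iff)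
qed

text \<open>The extremal tree is itself a spine whose pendant vertices have height 1, index
  \<open>c\<close> and parent \<open>c\<close>. This supplies the lower bounds on its distances;
  explicit walks supply the upper ones.\<close>

sublocale spine "{..<n}" E d "\<lambda>j. j" "\<lambda>v. if v \<le> d then v else c" "\<lambda>v. if v \<le> d then 0 else 1" "\<lambda>_. c"
proof
  fix u v assume "(u, v) \<in> E"
  then show "(\<exists>j<d. (u, v) = (j, Suc j) \<or> (v, u) = (j, Suc j))
      \<or> 0 < (if u \<le> d then 0 else 1 :: nat) \<and> v = c \<or> 0 < (if v \<le> d then 0 else 1 :: nat) \<and> u = c"
    by (force simp: E_iff Suc_le_eq)
qed (use c_le n sym_E in \<open>auto simp: E_iff split: if_splits\<close>)

lemma off_T: "off = {d<..<n}"
  unfolding off_def by auto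

lemma relpow_T_path:
  assumes "i \<le> d" "j \<le> d"
  shows "(i, j) \<in> E ^^ (i - j + (j - i))"
proof -
  have "(i, j) \<in> E ^^ (j - i)" if "i \<le> j" "j \<le> d" for i j
    using that by (intro relpow_path[where p = "\<lambda>j. j" and d = d]) (auto simp: E_iff)
  from this[of i j] this[of j i] relpow_sym[OF sym_E, of j i] assms show ?thesis
    by (cases "i \<le> j") auto
qed

lemma relpow_T_pendant:
  assumes "w \<in> off" "j \<le> d"
  shows "(w, j) \<in> E ^^ Suc (c - j + (j - c))"
proof (rule relpow_Suc_I2)
  show "(w, c) \<in> E" using assms by (auto simp: off_T E_iff)
  show "(c, j) \<in> E ^^ (c - j + (j - c))" using assms c_le by (intro relpow_T_path) auto
qed

lemma dist_T_path:
  assumes "i \<le> d" "j \<le> d"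
  shows "real (dist i j) = \<bar>real i - real j\<bar>"
  using reldist_le[OF relpow_T_path[OF assms]] dist_p_ge[of i j] assms n by auto

lemma dist_T_pendant:
  assumes "w \<in> off" "j \<le> d"
  shows "real (dist w j) = 1 + \<bar>real c - real j\<bar>"
  using reldist_le[OF relpow_T_pendant[OF assms]] dist_p_ge[of w j] assms by (auto simp: off_T)

lemma dist_T_pendants:
  assumes "u \<in> off" "v \<in> off" "u \<noteq> v"
  shows "dist u v = 2"
proof -
  have "(u, c) \<in> E" "(c, v) \<in> E" using assms by (auto simp: off_T E_iff)
  then have "(u, v) \<in> E ^^ 2" by (auto simp: numeral_2_eq_2)
  then have "dist u v \<le> 2" by (rule reldist_le)
  moreover have "(u, v) \<notin> E" using assms c_le by (auto simp: off_T E_iff)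
  ultimately show ?thesis using dist_off_ge[OF assms] assms by (auto simp: off_T)
qed

text \<open>Every vertex has at most one smaller neighbour, which the largest vertex of a cycle of
  length at least three would violate.\<close>

lemma undirected_tree_T: "undirected_tree T"
proof -
  interpret G: graph T by (rule graph_T)
  have conn: "u \<rightarrow>\<^sup>*\<^bsub>T\<^esub> v" if uv: "u \<in> verts T" "v \<in> verts T" for u v
  proof -
    have "(u, v) \<in> E\<^sup>*" using rtrancl_V uv by (simp add: verts_T)
    then obtain l where "(u, v) \<in> E ^^ l" by (auto simp: rtrancl_power)
    then obtain p where "G.awalk u p v" using G.relpow_imp_awalk[of u v l E] uv by auto
    then show ?thesis by (rule G.reachable_awalkI)
  qed
  have "connected T"
  proof (rule G.connectedI)
    show "verts T \<noteq> {}" using n by (auto simp: verts_T)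
    show "u \<rightarrow>\<^sup>*\<^bsub>with_proj (mk_symmetric T)\<^esub> v" if "u \<in> verts T" "v \<in> verts T" for u v
      using conn[OF that] by (rule G.reachable_mk_symmetricI)
  qed
  moreover have False if p: "G.cycle p" "3 \<le> length p" for p
  proof -
    let ?l = "length p"
    obtain f where f: "f 0 = f ?l" "inj_on f {1..?l}" "\<And>i. i < ?l \<Longrightarrow> (f i, f (Suc i)) \<in> E"
      using G.cycle_vertices[OF p(1)] by blast
    have "Max (f ` {1..?l}) \<in> f ` {1..?l}" using p(2) by (intro Max_in) auto
    then obtain i where "i \<in> {1..?l}" "Max (f ` {1..?l}) = f i" by blast
    then have i: "i \<in> {1..?l}" "\<And>j. j \<in> {1..?l} \<Longrightarrow> f j \<le> f i"
      by (metis Max_ge finite_atLeastAtMost finite_imageI imageI)+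
    \<comment> \<open>The cyclic neighbours of position \<open>i\<close>, with position 0 identified
      with \<open>?l\<close>; they differ because the length is at least 3.\<close>
    define a where "a = (if i = 1 then ?l else i - 1)"
    define b where "b = (if i = ?l then 1 else Suc i)"
    have ab: "a \<in> {1..?l}" "b \<in> {1..?l}" "a \<noteq> b" using i(1) p(2) by (auto simp: a_def b_def)
    have ne: "p \<noteq> []" using p(2) by auto
    then have "(f i, f b) \<in> E" using f(3)[of i] f(3)[of 0] i(1) f(1) by (auto simp: b_def)
    moreover have "(f a, f i) \<in> E" using f(3)[of "i - 1"] i(1) f(1) ne by (auto simp: a_def)
    moreover have "f a \<le> f i" "f b \<le> f i" using i ab by auto
    ultimately have "f a = f b" using c_le by (auto simp: E_iff)
    then show False using f(2) ab by (auto dest: inj_onD)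
  qed
  ultimately show ?thesis using graph_T by (auto simp: undirected_tree_def)
qed

lemma diameter_T: "graph_diameter T = d"
proof -
  have le: "dist u v \<le> d" if "u < n" "v < n" for u v
  proof -
    \<comment> \<open>One less than \<open>d\<close>, to leave room for the pendant edge.\<close>
    have c2: "\<bar>real c - real j\<bar> \<le> real d - 1" if "j \<le> d" for j
    proof -
      have "1 \<le> c" using d by (simp add: c_def)
      then show ?thesis using that c_le by (simp add: abs_if)
    qed
    have V: "u \<le> d \<or> u \<in> off" "v \<le> d \<or> v \<in> off" using that by (auto simp: off_T)
    consider "u \<le> d" "v \<le> d" | "u \<in> off" "v \<le> d" | "u \<le> d" "v \<in> off" | "u = v" "u \<in> off"
      | "u \<in> off" "v \<in> off" "u \<noteq> v"
      using V by blast
    then have "real (dist u v) \<le> real d"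
    proof cases
      case 1
      then show ?thesis by (simp add: dist_T_path)
    next
      case 2
      then show ?thesis using c2[of v] by (simp add: dist_T_pendant)
    next
      case 3
      then show ?thesis using c2[of u] by (subst reldist_commute[OF sym_E]) (simp add: dist_T_pendant)
    next
      case 4
      then show ?thesis using reldist_le[of u u 0 E] by simp
    next
      case 5
      then show ?thesis using d by (simp add: dist_T_pendants)
    qed
    then show ?thesis by simp
  qed
  have gd: "graph_dist T u v = dist u v" if "u < n" "v < n" for u v
    using that by (intro undirected_tree_dist[OF undirected_tree_T]) (auto simp: verts_T)
  let ?S = "{graph_dist T u v | u v. u \<in> verts T \<and> v \<in> verts T}"
  have "?S = (\<lambda>(u, v). graph_dist T u v) ` ({..<n} \<times> {..<n})" by (auto simp: verts_T)
  then have "finite ?S" by simp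
  moreover have "x \<le> d" if "x \<in> ?S" for x using that gd le by (auto simp: verts_T)
  moreover have "d \<in> ?S"
  proof -
    have "graph_dist T 0 d = d" using dist_T_path[of 0 d] gd[of 0 d] n by simp
    then show ?thesis using n by (intro CollectI exI[of _ 0] exI[of _ d]) (simp add: verts_T)
  qed
  ultimately show ?thesis unfolding graph_diameter_def by (intro Max_eqI) auto
qed

end

section \<open>Perron vector of the extremal tree, equality case and comparison\<close>

context centred
begin

abbreviation "m \<equiv> n - Suc d"

lemma card_off_T: "card off = m"
  by (simp add: off_T)

text \<open>The pendant vertices are twins, so a Perron vector takes the same value on all of them.\<close>

lemma perron_T:
  obtains \<xi> :: "nat \<Rightarrow> real" and y :: real
  where "\<And>j. j \<le> d \<Longrightarrow> 0 < \<xi> j" "0 < y"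
    and "m = 0 \<or> perron d m c \<xi> y (dist_spectral_radius T)"
    and "dist_spectral_radius T * ((\<Sum>j\<le>d. (\<xi> j)\<^sup>2) + real m * y\<^sup>2)
      = (\<Sum>i\<le>d. \<Sum>j\<le>d. \<bar>real i - real j\<bar> * \<xi> i * \<xi> j)
        + 2 * y * (real m * (\<Sum>j\<le>d. (1 + \<bar>real c - real j\<bar>) * \<xi> j))
        + y\<^sup>2 * (2 * real m * (real m - 1))"
proof -
  let ?l = "dist_spectral_radius T" and ?V = "{..<n}"
  have "2 \<le> card (verts T)" using d n by (simp add: verts_T)
  from undirected_tree_spectral_radius[OF undirected_tree_T this, unfolded verts_T]
  obtain x where x: "\<And>v. v \<in> ?V \<Longrightarrow> 0 < x v"
    and ev: "\<And>u. u \<in> ?V \<Longrightarrow> (\<Sum>v\<in>?V. real (dist u v) * x v) = ?l * x u"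
    by metis
  \<comment> \<open>Without pendant vertices \<open>Suc d\<close> is not a vertex, and any positive
    value serves.\<close>
  define y where "y = (if m = 0 then 1 else x (Suc d))"
  have y_pos: "0 < y" using x n by (auto simp: y_def)
  have x_pos: "0 < x j" if "j \<le> d" for j using that n by (intro x) auto
  have split: "sum F ?V = (\<Sum>j\<le>d. F j) + sum F off" for F :: "nat \<Rightarrow> real"
  proof -
    have "?V = {..d} \<union> {d<..<n}" using n by auto
    then have "sum F ?V = sum F ({..d} \<union> {d<..<n})" by (rule arg_cong)
    also have "\<dots> = sum F {..d} + sum F {d<..<n}" by (intro sum.union_disjoint) auto
    finally show ?thesis by (simp only: off_T)
  qed
  have zero: "dist u u = 0" for u using reldist_le[of u u 0 E] by simp
  have l_pos: "0 < ?l"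
  proof -
    have "0 < (\<Sum>v\<in>?V. real (dist 0 v) * x v)"
    proof (rule sum_pos2[where i = d])
      show "0 < real (dist 0 d) * x d" using d x_pos[of d] dist_T_path[of 0 d] by simp
    qed (use n x in \<open>auto intro!: mult_nonneg_nonneg intro: less_imp_le\<close>)
    then show ?thesis using ev[of 0] n x_pos[of 0] by (simp add: zero_less_mult_iff)
  qed
  have twin: "x w = y" if w: "w \<in> off" for w
  proof -
    define w' where "w' = Suc d"
    have w': "w' \<in> off" using w by (auto simp: w'_def off_T)
    have V: "w \<in> ?V" "w' \<in> ?V" using w w' by (auto simp: off_T)
    \<comment> \<open>The rows of two pendant vertices differ only in their own entries, where 0
      replaces the common distance 2.\<close>
    have "(?l + 2) * (x w - x w') = 0"
    proof (cases "w = w'")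
      case False
      have row: "?l * x a = (\<Sum>j\<le>d. (1 + \<bar>real c - real j\<bar>) * x j) + 2 * sum x off - 2 * x a"
        if a: "a \<in> off" for a
      proof -
        have "(\<Sum>v\<in>off. real (dist a v) * x v) = (\<Sum>v\<in>off. 2 * x v - (if v = a then 2 * x a else 0))"
          using a by (intro sum.cong) (auto simp: dist_T_pendants zero)
        also have "\<dots> = 2 * sum x off - 2 * x a"
          using a fin_off by (simp add: sum_subtractf sum_distrib_left)
        finally show ?thesis
          using ev[of a] a by (simp add: split dist_T_pendant off_T)
      qed
      from row[OF w] row[OF w'] show ?thesis by (simp add: algebra_simps)
    qed simp
    then show ?thesis using l_pos w by (auto simp: w'_def y_def off_T)
  qed
  have ev_path: "(\<Sum>j\<le>d. \<bar>real i - real j\<bar> * x j) + real m * y * (1 + \<bar>real i - real c\<bar>) = ?l * x i"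
    if i: "i \<le> d" for i
  proof -
    have "(\<Sum>w\<in>off. real (dist i w) * x w) = (\<Sum>w\<in>off. (1 + \<bar>real i - real c\<bar>) * y)"
      using i by (intro sum.cong)
        (auto simp: twin reldist_commute[OF sym_E, of i] dist_T_pendant abs_minus_commute)
    then show ?thesis using ev[of i] i n by (simp add: split dist_T_path card_off_T ac_simps)
  qed
  have ev_pendant: "(\<Sum>j\<le>d. (1 + \<bar>real c - real j\<bar>) * x j) + 2 * (real m - 1) * y = ?l * y"
    if m: "0 < m"
  proof -
    define w where "w = Suc d"
    have w: "w \<in> off" using m by (auto simp: off_T w_def)
    have "(\<Sum>v\<in>off. real (dist w v) * x v) = (\<Sum>v\<in>off. 2 * y - (if v = w then 2 * y else 0))"
      using w by (intro sum.cong) (auto simp: dist_T_pendants zero twin)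
    also have "\<dots> = 2 * (real m - 1) * y"
      using w fin_off by (simp add: sum_subtractf card_off_T algebra_simps)
    finally show ?thesis using ev[of w] w by (simp add: split dist_T_pendant off_T twin)
  qed
  show thesis
  proof (rule that[OF x_pos y_pos])
    show "m = 0 \<or> perron d m c x y ?l"
      using d c_def x_pos y_pos ev_path ev_pendant by (auto intro!: perron.intro)
    have "(\<Sum>u\<in>?V. \<Sum>v\<in>?V. real (dist u v) * x u * x v) = (\<Sum>u\<in>?V. x u * (\<Sum>v\<in>?V. real (dist u v) * x v))"
      by (simp add: sum_distrib_left ac_simps)
    also have "\<dots> = ?l * (\<Sum>v\<in>?V. (x v)\<^sup>2)"
      unfolding sum_distrib_left[of ?l] by (intro sum.cong) (simp_all add: ev power2_eq_square)
    also have "(\<Sum>v\<in>?V. (x v)\<^sup>2) = (\<Sum>j\<le>d. (x j)\<^sup>2) + real m * y\<^sup>2"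
      by (simp add: split twin card_off_T)
    finally have "?l * ((\<Sum>j\<le>d. (x j)\<^sup>2) + real m * y\<^sup>2)
        = (\<Sum>u\<in>?V. \<Sum>v\<in>?V. real (dist u v) * x u * x v)" by simp
    \<comment> \<open>The vector is put into the shape that \<open>quad_form_split\<close> expects,
      with the identity as path.\<close>
    also have "\<dots> = (\<Sum>u\<in>?V. \<Sum>v\<in>?V. real (dist u v) * (if u \<in> (\<lambda>j. j) ` {..d} then x (if u \<le> d then u else c) else y)
        * (if v \<in> (\<lambda>j. j) ` {..d} then x (if v \<le> d then v else c) else y))"
      by (intro sum.cong) (auto simp: twin off_T)
    also have "\<dots> = (\<Sum>i\<le>d. \<Sum>j\<le>d. real (dist i j) * x i * x j)
        + 2 * y * (\<Sum>w\<in>off. \<Sum>j\<le>d. real (dist w j) * x j) + y\<^sup>2 * (\<Sum>u\<in>off. \<Sum>v\<in>off. real (dist u v))"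
      by (rule quad_form_split(1)) (simp add: reldist_commute[OF sym_E])
    also have "(\<Sum>i\<le>d. \<Sum>j\<le>d. real (dist i j) * x i * x j) = (\<Sum>i\<le>d. \<Sum>j\<le>d. \<bar>real i - real j\<bar> * x i * x j)"
      by (simp add: dist_T_path)
    also have "(\<Sum>w\<in>off. \<Sum>j\<le>d. real (dist w j) * x j) = real m * (\<Sum>j\<le>d. (1 + \<bar>real c - real j\<bar>) * x j)"
      by (simp add: dist_T_pendant card_off_T)
    also have "(\<Sum>u\<in>off. \<Sum>v\<in>off. real (dist u v)) = (\<Sum>u\<in>off. \<Sum>v\<in>off. 2 - (if v = u then 2 else 0))"
      by (intro sum.cong) (auto simp: dist_T_pendants zero)
    also have "\<dots> = 2 * real m * (real m - 1)"
      using fin_off by (simp add: sum_subtractf card_off_T algebra_simps)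
    finally show "?l * ((\<Sum>j\<le>d. (x j)\<^sup>2) + real m * y\<^sup>2)
      = (\<Sum>i\<le>d. \<Sum>j\<le>d. \<bar>real i - real j\<bar> * x i * x j)
        + 2 * y * (real m * (\<Sum>j\<le>d. (1 + \<bar>real c - real j\<bar>) * x j))
        + y\<^sup>2 * (2 * real m * (real m - 1))" .
  qed
qed

text \<open>Height 1 and index \<open>c\<close> make \<open>p c\<close> the parent of every vertex
  off the path. Hence \<open>p j\<close> can be sent to \<open>j\<close> and the remaining vertices
  to the pendant ones by any bijection.\<close>

lemma iso_T:
  assumes G: "graph G" and card: "card (verts G) = n"
    and S: "spine (verts G) (arcs_ends G) d p idx ht par"
    and off: "\<And>w. w \<in> verts G - p ` {..d} \<Longrightarrow> ht w = 1 \<and> idx w = c"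
  shows "digraph_iso G T"
proof -
  interpret G: graph G by (rule G)
  interpret S: spine "verts G" "arcs_ends G" d p idx ht par by (rule S)
  have "card S.off = card {d<..<n}" using S.card_off card by simp
  from finite_same_card_bij[OF S.fin_off finite_greaterThanLessThan this]
  obtain g where g: "bij_betw g S.off {d<..<n}" by blast
  define f where "f v = (if v \<in> S.off then g v else idx v)" for v
  have f_p: "f (p j) = j" if "j \<le> d" for j using that by (simp add: f_def S.off_iff S.idx_p)
  have f_off: "f w \<in> {d<..<n}" if "w \<in> S.off" for w using that g by (auto simp: f_def bij_betw_def)
  have V: "verts G = p ` {..d} \<union> S.off" using S.p_V by (auto simp: S.off_def)
  have f_le: "f v \<le> d \<longleftrightarrow> v \<notin> S.off" if "v \<in> verts G" for v
    using f_off[of v] S.idx_le[OF that] by (auto simp: f_def)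
  have inj: "inj_on f (verts G)"
  proof
    fix u v assume uv: "u \<in> verts G" "v \<in> verts G" "f u = f v"
    show "u = v"
    proof (cases "u \<in> S.off")
      case True
      then have "v \<in> S.off" using uv f_le by metis
      then show ?thesis using True uv g by (auto simp: f_def bij_betw_def dest: inj_onD)
    next
      case False
      then have "v \<notin> S.off" using uv f_le by metis
      then have "u \<in> p ` {..d}" "v \<in> p ` {..d}" using False uv(1,2) by (auto simp: S.off_def)
      then obtain i j where "u = p i" "v = p j" "i \<le> d" "j \<le> d" by blast
      then show ?thesis using uv f_p by simp
    qed
  qed
  have img: "f ` verts G = {..<n}"
  proof -
    have "f ` p ` {..d} = {..d}" using f_p by (force simp: image_image)
    moreover have "f ` S.off = {d<..<n}" using g by (simp add: f_def bij_betw_def)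
    moreover have "{..<n} = {..d} \<union> {d<..<n}" using n by auto
    moreover have "f ` verts G = f ` p ` {..d} \<union> f ` S.off"
      unfolding image_Un[symmetric] by (rule arg_cong[OF V])
    ultimately show ?thesis by simp
  qed
  have par: "par w = p c" if "w \<in> S.off" for w
  proof -
    have w: "w \<in> verts G" "0 < ht w" "ht w = 1" "idx w = c" using that off by (auto simp: S.off_def S.off_iff)
    then have "par w \<in> p ` {..d}" "idx (par w) = c"
      using S.ht_par[of w] S.par_V[of w] S.ht_0[of "par w"] S.idx_par[of w] by auto
    then show ?thesis using S.idx_p by auto
  qed
  have ends: "map_prod f f ` arcs_ends G = E"
  proof (intro equalityI subsetI)
    fix e assume "e \<in> map_prod f f ` arcs_ends G"
    then obtain u v where uv: "(u, v) \<in> arcs_ends G" "e = (f u, f v)" by auto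
    have fp: "f (p c) = c" using f_p c_le by simp
    have "u \<in> verts G" "v \<in> verts G" using uv S.E_ends by auto
    with S.E_cases[OF uv(1)] show "e \<in> E"
      using par[of u] par[of v] f_off[of u] f_off[of v] fp f_p
      by (auto simp: uv(2) E_iff S.off_iff)
  next
    fix e assume e: "e \<in> E"
    have sym: "(v, u) \<in> map_prod f f ` arcs_ends G" if "(u, v) \<in> map_prod f f ` arcs_ends G" for u v
      using that S.sym_E by (force dest: symD)
    have path: "(j, Suc j) \<in> map_prod f f ` arcs_ends G" if "j < d" for j
      using S.path_E[OF that] f_p that by (force intro!: image_eqI[of _ _ "(p j, p (Suc j))"])
    have pend: "(w, c) \<in> map_prod f f ` arcs_ends G" if w: "w \<in> {d<..<n}" for w
    proof -
      have "w \<in> g ` S.off" using g w by (simp add: bij_betw_def)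
      then obtain v where v: "v \<in> S.off" "w = f v" by (auto simp: f_def)
      then have "(v, p c) \<in> arcs_ends G" using S.par_E[of v] par[of v] by (simp add: S.off_iff)
      then show ?thesis using f_p[of c] c_le v by (force intro!: image_eqI[of _ _ "(v, p c)"])
    qed
    show "e \<in> map_prod f f ` arcs_ends G"
      using e path pend sym by (cases e) (auto simp: E_iff Suc_le_eq)
  qed
  \<comment> \<open>Arcs of the target are pairs, so an arc goes to the pair of images of its ends;
    this is injective because there are no multiple arcs.\<close>
  let ?h = "\<lparr>iso_verts = f, iso_arcs = \<lambda>a. (f (tail G a), f (head G a)), iso_head = snd, iso_tail = fst\<rparr>"
  have "pre_digraph.digraph_isomorphism G ?h"
    unfolding pre_digraph.digraph_isomorphism_def
  proof (intro conjI ballI)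
    show "wf_digraph G" ..
    show "inj_on (iso_arcs ?h) (arcs G)"
    proof
      fix a b assume ab: "a \<in> arcs G" "b \<in> arcs G" "iso_arcs ?h a = iso_arcs ?h b"
      then have "arc_to_ends G a = arc_to_ends G b"
        using inj_onD[OF inj, of "tail G a" "tail G b"] inj_onD[OF inj, of "head G a" "head G b"]
        by (simp add: arc_to_ends_def)
      then show "a = b" using ab G.no_multi_arcs by blast
    qed
  qed (use inj in auto)
  moreover have "T = app_iso ?h G"
  proof (rule pre_digraph.equality)
    show "arcs T = arcs (app_iso ?h G)"
      using ends unfolding E_eq by (simp add: app_iso_def arcs_ends_conv image_image)
    show "verts T = verts (app_iso ?h G)" by (simp add: app_iso_def verts_T img)
  qed (simp_all add: app_iso_def centred_tree_def)
  ultimately show ?thesis unfolding digraph_iso_def by blast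
qed

text \<open>The transplanted vector has the same squared norm \<open>N\<close> as the Perron vector
  of \<open>T\<close>, and its quadratic form exceeds \<open>?l * N\<close> by at least \<Gamma>.
  Both claims follow from \<open>?l * N + \<Gamma> \<le> ?L * N\<close> and the sign and equality
  case of \<Gamma>.\<close>

lemma extremal:
  assumes G: "undirected_tree G" and card: "card (verts G) = n" and diam: "graph_diameter G = d"
  shows "dist_spectral_radius T \<le> dist_spectral_radius G"
    and "dist_spectral_radius G = dist_spectral_radius T \<longleftrightarrow> digraph_iso G T"
proof -
  interpret G: graph G using G by (simp add: undirected_tree_def)
  obtain p where "\<And>j. j \<le> d \<Longrightarrow> p j \<in> verts G"
    "\<And>j. j < d \<Longrightarrow> (p j, p (Suc j)) \<in> arcs_ends G" "inj_on p {..d}"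
    using diametral_path[OF G diam] by blast
  then obtain idx0 ht par where S0: "spine (verts G) (arcs_ends G) d p idx0 ht par"
    using tree_spine[OF G] by blast
  have "\<exists>p idx. spine (verts G) (arcs_ends G) d p idx ht par
      \<and> m \<le> 2 * card {w \<in> verts G - p ` {..d}. idx w \<le> c}"
  proof -
    interpret S0: spine "verts G" "arcs_ends G" d p idx0 ht par by (rule S0)
    \<comment> \<open>The vertices hanging from the left half before and after reversal. An index
      above \<open>c\<close> has reversed index at most \<open>d - Suc c \<le> c\<close>, so the two
      sets cover all hanging vertices and one holds at least half of them.\<close>
    let ?A = "{w \<in> S0.off. idx0 w \<le> c}" and ?B = "{w \<in> S0.off. d - idx0 w \<le> c}"
    have "S0.off \<subseteq> ?A \<union> ?B" by (auto simp: c_def)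
    then have "card S0.off \<le> card (?A \<union> ?B)" using S0.fin_off by (intro card_mono) auto
    also have "\<dots> \<le> card ?A + card ?B" by (rule card_Un_le)
    finally consider "m \<le> 2 * card ?A" | "m \<le> 2 * card ?B" using S0.card_off card by linarith
    then show ?thesis
    proof cases
      case 1
      then show ?thesis using S0 unfolding S0.off_def by blast
    next
      case 2
      show ?thesis
      proof (intro exI conjI)
        show "spine (verts G) (arcs_ends G) d (\<lambda>j. p (d - j)) (\<lambda>v. d - idx0 v) ht par"
          by (rule S0.spine_reverse)
        show "m \<le> 2 * card {w \<in> verts G - (\<lambda>j. p (d - j)) ` {..d}. d - idx0 w \<le> c}"
          using 2 by (simp only: image_atMost_reflect S0.off_def)
      qed
    qed
  qed
  then obtain p idx where S: "spine (verts G) (arcs_ends G) d p idx ht par"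
    and half: "m \<le> 2 * card {w \<in> verts G - p ` {..d}. idx w \<le> c}" by blast
  interpret S: spine "verts G" "arcs_ends G" d p idx ht par by (rule S)
  have cardW: "card S.off = m" using S.card_off card by simp
  let ?l = "dist_spectral_radius T" and ?L = "dist_spectral_radius G"
  obtain \<xi> y where \<xi>: "\<And>j. j \<le> d \<Longrightarrow> 0 < \<xi> j" and y: "0 < (y :: real)"
    and P: "m = 0 \<or> perron d m c \<xi> y ?l"
    and val: "?l * ((\<Sum>j\<le>d. (\<xi> j)\<^sup>2) + real m * y\<^sup>2)
      = (\<Sum>i\<le>d. \<Sum>j\<le>d. \<bar>real i - real j\<bar> * \<xi> i * \<xi> j)
        + 2 * y * (real m * (\<Sum>j\<le>d. (1 + \<bar>real c - real j\<bar>) * \<xi> j))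
        + y\<^sup>2 * (2 * real m * (real m - 1))"
    using perron_T by blast
  define X where "X = (\<Sum>j\<le>d. \<xi> j)"
  define f where "f i = (\<Sum>j\<le>d. \<bar>real i - real j\<bar> * \<xi> j)" for i
  define N where "N = (\<Sum>j\<le>d. (\<xi> j)\<^sup>2) + real m * y\<^sup>2"
  define \<Gamma> where "\<Gamma> = 2 * y * (\<Sum>w\<in>S.off. (real (ht w) - 1) * (X - y) + (f (idx w) - f c))
       + y\<^sup>2 * (\<Sum>u\<in>S.off. \<Sum>w\<in>S.off. \<bar>real (idx u) - real (idx w)\<bar>)"
  have N: "0 < N"
  proof -
    have "0 < (\<Sum>j\<le>d. (\<xi> j)\<^sup>2)" using \<xi> by (intro sum_pos) (auto simp: less_imp_neq[symmetric])
    then show ?thesis unfolding N_def by (intro add_pos_nonneg) auto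
  qed
  have gain: "?l * N + \<Gamma> \<le> ?L * N"
  proof -
    define z where "z v = (if v \<in> p ` {..d} then \<xi> (idx v) else y)" for v
    have "2 \<le> card (verts G)" using card d n by simp
    then have "quad_form (verts G) (\<lambda>u v. real (S.dist u v)) z \<le> ?L * (\<Sum>v\<in>verts G. (z v)\<^sup>2)"
      using undirected_tree_spectral_radius[OF G] by metis
    also have "(\<Sum>v\<in>verts G. (z v)\<^sup>2) = N"
      unfolding z_def N_def
      using S.quad_form_split(2)[of "\<lambda>u v. real (S.dist u v)" \<xi> y] reldist_commute[OF S.sym_E] cardW
      by simp
    finally have le: "(\<Sum>u\<in>verts G. \<Sum>v\<in>verts G. real (S.dist u v) * z u * z v) \<le> ?L * N"
      by (simp add: quad_form_def)
    have row: "(\<Sum>j\<le>d. (real h + \<bar>real i - real j\<bar>) * \<xi> j) = real h * X + f i" for h i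
      by (simp add: X_def f_def ring_distribs sum.distrib sum_distrib_left)
    have "(\<Sum>i\<le>d. \<Sum>j\<le>d. \<bar>real i - real j\<bar> * \<xi> i * \<xi> j)
       + 2 * y * (\<Sum>w\<in>S.off. real (ht w) * X + f (idx w))
       + y\<^sup>2 * (2 * real m * (real m - 1)
        + (\<Sum>u\<in>S.off. \<Sum>v\<in>S.off. \<bar>real (idx u) - real (idx v)\<bar>) - 2 * (\<Sum>w\<in>S.off. real (ht w) - 1))
       \<le> (\<Sum>u\<in>verts G. \<Sum>v\<in>verts G. real (S.dist u v) * z u * z v)"
      unfolding z_def using S.quad_form_dist_ge[of \<xi> y] \<xi> y cardW by (simp add: row less_imp_le)
    also note le
    finally have "(\<Sum>i\<le>d. \<Sum>j\<le>d. \<bar>real i - real j\<bar> * \<xi> i * \<xi> j)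
       + 2 * y * (\<Sum>w\<in>S.off. real (ht w) * X + f (idx w))
       + y\<^sup>2 * (2 * real m * (real m - 1)
        + (\<Sum>u\<in>S.off. \<Sum>v\<in>S.off. \<bar>real (idx u) - real (idx v)\<bar>) - 2 * (\<Sum>w\<in>S.off. real (ht w) - 1))
       \<le> ?L * N" .
    moreover have "?l * N = (\<Sum>i\<le>d. \<Sum>j\<le>d. \<bar>real i - real j\<bar> * \<xi> i * \<xi> j)
        + 2 * y * (real m * (X + f c)) + y\<^sup>2 * (2 * real m * (real m - 1))"
      using val row[of 1 c] by (simp add: N_def)
    \<comment> \<open>Pure algebra with the sums abstracted to real variables: the edge loss
      \<open>- 2 * h\<close> under \<open>y\<^sup>2\<close> becomes \<open>- y * h\<close> under the
      factor \<open>2 * y\<close>, where it joins the height gain.\<close>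
    moreover have "p + 2 * y * s + y\<^sup>2 * (q + t - 2 * h) \<le> a \<Longrightarrow> b = p + 2 * y * k + y\<^sup>2 * q
      \<Longrightarrow> b + (2 * y * (s - k - y * h) + y\<^sup>2 * t) \<le> a" for p q s t h k a b :: real
      by (simp add: algebra_simps power2_eq_square)
    moreover have eq: "(\<Sum>w\<in>S.off. (real (ht w) - 1) * (X - y) + (f (idx w) - f c))
        = (\<Sum>w\<in>S.off. real (ht w) * X + f (idx w)) - real m * (X + f c) - y * (\<Sum>w\<in>S.off. real (ht w) - 1)"
    proof -
      have "(\<Sum>w\<in>S.off. (real (ht w) - 1) * (X - y) + (f (idx w) - f c))
          = (\<Sum>w\<in>S.off. (real (ht w) * X + f (idx w)) - (X + f c) - y * (real (ht w) - 1))"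
        by (intro sum.cong) (auto simp: algebra_simps)
      then show ?thesis by (simp add: sum_subtractf cardW flip: sum_distrib_left)
    qed
    ultimately show ?thesis unfolding \<Gamma>_def eq by blast
  qed
  have \<Gamma>: "0 \<le> \<Gamma> \<and> (\<Gamma> \<le> 0 \<longrightarrow> (\<forall>w\<in>S.off. ht w = 1 \<and> idx w = c))"
  proof (cases "m = 0")
    case True
    then have "S.off = {}" using cardW S.fin_off by simp
    then show ?thesis by (simp add: \<Gamma>_def)
  next
    case False
    then interpret P: perron d m c \<xi> y ?l using P by simp
    have f: "f = P.f" by (simp add: fun_eq_iff f_def P.f_def)
    have h: "1 \<le> ht w" if "w \<in> S.off" for w using that by (simp add: S.off_iff)
    from P.gain[where h = ht and t = idx, OF S.fin_off cardW h half[folded S.off_def]] show ?thesis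
      unfolding \<Gamma>_def f X_def by blast
  qed
  have "?l * N \<le> ?L * N" using gain \<Gamma> by linarith
  then show "?l \<le> ?L" using N by simp
  show "?L = ?l \<longleftrightarrow> digraph_iso G T"
  proof
    assume "?L = ?l"
    then have "\<Gamma> \<le> 0" using gain by simp
    then have "\<forall>w\<in>S.off. ht w = 1 \<and> idx w = c" using \<Gamma> by blast
    then show "digraph_iso G T"
      using iso_T[OF _ card S] G by (simp add: S.off_def undirected_tree_def)
  next
    assume "digraph_iso G T"
    then show "?L = ?l" by (rule dist_spectral_radius_iso[OF G undirected_tree_T])
  qed
qed

end

theorem theorem3p4:
  shows "(\<forall>k n :: nat. 2 \<le> k \<and> 2 * k \<le> n \<longrightarrow>
           (undirected_tree (T1 n k) \<and> card (verts (T1 n k)) = n \<and>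
            graph_diameter (T1 n k) = 2 * k - 1) \<and>
           (\<forall>T :: ('a, 'b) pre_digraph.
              undirected_tree T \<and> card (verts T) = n \<and> graph_diameter T = 2 * k - 1 \<longrightarrow>
              dist_spectral_radius T \<ge> dist_spectral_radius (T1 n k) \<and>
              (dist_spectral_radius T = dist_spectral_radius (T1 n k) \<longleftrightarrow> digraph_iso T (T1 n k))))
       \<and> (\<forall>k n :: nat. 1 \<le> k \<and> 2 * k + 1 \<le> n \<longrightarrow>
           (undirected_tree (T2 n k) \<and> card (verts (T2 n k)) = n \<and>
            graph_diameter (T2 n k) = 2 * k) \<and>
           (\<forall>T :: ('a, 'b) pre_digraph.
              undirected_tree T \<and> card (verts T) = n \<and> graph_diameter T = 2 * k \<longrightarrow>
              dist_spectral_radius T \<ge> dist_spectral_radius (T2 n k) \<and>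
              (dist_spectral_radius T = dist_spectral_radius (T2 n k) \<longleftrightarrow> digraph_iso T (T2 n k))))"
proof (intro conjI allI impI; (elim conjE)?)
  fix k n :: nat assume k: "2 \<le> k" "2 * k \<le> n"
  then interpret centred n "2 * k - 1" "(2 * k - 1) div 2" by unfold_locales auto
  have T: "T1 n k = centred_tree n (2 * k - 1)" using k by (intro T1_eq_centred_tree) simp
  show "undirected_tree (T1 n k)" "card (verts (T1 n k)) = n" "graph_diameter (T1 n k) = 2 * k - 1"
    unfolding T using undirected_tree_T verts_T diameter_T by simp_all
  fix G :: "('a, 'b) pre_digraph"
  assume "undirected_tree G" "card (verts G) = n" "graph_diameter G = 2 * k - 1"
  from extremal[OF this]
  show "dist_spectral_radius (T1 n k) \<le> dist_spectral_radius G"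
    "(dist_spectral_radius G = dist_spectral_radius (T1 n k)) = digraph_iso G (T1 n k)"
    unfolding T by simp_all
next
  fix k n :: nat assume k: "1 \<le> k" "2 * k + 1 \<le> n"
  then interpret centred n "2 * k" "2 * k div 2" by unfold_locales auto
  note T = T2_eq_centred_tree
  show "undirected_tree (T2 n k)" "card (verts (T2 n k)) = n" "graph_diameter (T2 n k) = 2 * k"
    unfolding T using undirected_tree_T verts_T diameter_T by simp_all
  fix G :: "('a, 'b) pre_digraph"
  assume "undirected_tree G" "card (verts G) = n" "graph_diameter G = 2 * k"
  from extremal[OF this]
  show "dist_spectral_radius (T2 n k) \<le> dist_spectral_radius G"
    "(dist_spectral_radius G = dist_spectral_radius (T2 n k)) = digraph_iso G (T2 n k)"
    unfolding T by simp_all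
qed

end
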